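(* Let $(f_n)$ be a sequence of log-concave densities on $\mathbb{R}^d$ with $f_n \stackrel{d}{\rightarrow} f$ for some density $f$. Then: (a) $f$ is log-concave. (b) $f_n \to f$, $\mu$-almost everywhere. (c) Let $a_0 > 0$ and $b_0 \in \mathbb{R}$ be such that $f(x) \leq e^{-a_0\|x\|+b_0}$ for all $x \in \mathbb{R}^d$. Then for every $a < a_0$, we have \[ \int_{\mathbb{R}^d} e^{a\|x\|}\,|f_n(x) - f(x)|\,dx \to 0 \quad \text{as } n \to \infty, \] and, if $f$ is continuous, \[ \sup_{x \in \mathbb{R}^d} e^{a\|x\|}\,|f_n(x) - f(x)| \to 0 \quad \text{as } n \to \infty. \]
   Context: Here $\mu$ denotes Lebesgue measure on $\mathbb{R}^d$, densities are probability densities with respect to $\mu$, and $\|\cdot\|$ is the Euclidean norm. A density $f$ on $\mathbb{R}^d$ is log-concave if $\log f$ is a concave function taking values in $[-\infty,\infty)$ (with $\log 0 = -\infty$). For densities $f,f_1,f_2,\ldots$ on $\mathbb{R}^d$, $f_n \stackrel{d}{\rightarrow} f$ denotes convergence in distribution of the corresponding measures: $\int g(x) f_n(x)\,dx \to \int g(x) f(x)\,dx$ for all bounded, continuous functions $g:\mathbb{R}^d \to \mathbb{R}$.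
   Formalization: Part (a) is stated as: f agrees almost everywhere with a log-concave density. Pointwise, (a) fails for an arbitrary density f: take all f_n Gaussian and f the same Gaussian with its value at 0 changed to 0. *)

theory Defs
  imports "HOL-Probability.Probability"
begin

definition prob_density :: "('a::euclidean_space \<Rightarrow> real) \<Rightarrow> bool" where
  "prob_density f \<longleftrightarrow>
     f \<in> borel_measurable lebesgue \<and> (\<forall>x. 0 \<le> f x) \<and>
     prob_space (density lebesgue (\<lambda>x. ennreal (f x)))"

(* The real-valued ln is total with an unwanted value at 0, and concave_on is restricted to
   real-valued functions, so concavity of a [-\<infinity>,\<infinity>)-valued logarithm is spelled out in ereal. *)
definition log0 :: "real \<Rightarrow> ereal" where
  "log0 r = (if r = 0 then -\<infinity> else ereal (ln r))"

(* In the inequality no summand is +\<infinity>; for t in the open unit interval, t * (-\<infinity>) = -\<infinity>. *)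
definition log_concave_density :: "('a::euclidean_space \<Rightarrow> real) \<Rightarrow> bool" where
  "log_concave_density f \<longleftrightarrow>
     prob_density f \<and>
     (\<forall>x y t. 0 < t \<and> t < 1 \<longrightarrow>
        ereal (1 - t) * log0 (f x) + ereal t * log0 (f y)
          \<le> log0 (f ((1 - t) *\<^sub>R x + t *\<^sub>R y)))"

definition conv_in_distr :: "(nat \<Rightarrow> 'a::euclidean_space \<Rightarrow> real) \<Rightarrow> ('a \<Rightarrow> real) \<Rightarrow> bool" where
  "conv_in_distr fs f \<longleftrightarrow>
     (\<forall>g :: 'a \<Rightarrow> real. continuous_on UNIV g \<and> bounded (range g) \<longrightarrow>
        (\<lambda>n. \<integral>x. g x * fs n x \<partial>lebesgue) \<longlonglongrightarrow> (\<integral>x. g x * f x \<partial>lebesgue))"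

end

theory Submission
  imports Defs
begin

text \<open>
  Testing against bumps shows that, near any point of the interior \<open>U\<close> of the convex hull of the
  support of \<open>f\<close>, the \<open>f\<^sub>n\<close> are eventually bounded below: they are large somewhere near each of
  finitely many support points, hence on the hull of such points.
  Combined with log-concavity and total mass 1 this gives a uniform upper bound, hence local
  equi-Lipschitz continuity on \<open>U\<close>, hence pointwise convergence there; off the closure of \<open>U\<close>
  the \<open>f\<^sub>n\<close> tend to 0, and the frontier of a convex set is null. The limit inherits
  log-concavity and, by dominated convergence, agrees with \<open>f\<close> almost everywhere. If \<open>f\<close> decays
  exponentially, then the \<open>f\<^sub>n\<close> are small on a large sphere, and log-concavity along rays
  extends this to a common exponential bound, which dominates everything in (c).
\<close>

section \<open>Log-concave functions\<close>

text \<open>Weak convergence controls averages only: near a given point it yields one good value of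
  \<open>fs n\<close>, at an unknown place that moves with n. The convexity lemmas are built to work
  from such scattered values. Lower bounds pass from finitely many perturbed points to a ball inside
  their hull. Upper bounds need an anchor: a ball \<open>ball z r\<close> on which all late
  \<open>fs n\<close> are at least \<open>c\<close>. Log-concavity averages a single large value
  with this anchor and spreads it over a ball of positive volume, where an integral can see it. The
  same anchor serves the global bound, the local upper bounds and the decay along rays.
  Log-concavity is used in multiplicative form, where \<open>0 powr t = 0\<close> plays the part of
  the value -\<infinity> of the logarithm.\<close>

definition log_concave_fun :: "('a::real_vector \<Rightarrow> real) \<Rightarrow> bool" where
  "log_concave_fun F \<longleftrightarrow> (\<forall>x. 0 \<le> F x) \<and>
     (\<forall>x y t. 0 < t \<and> t < 1 \<longrightarrow>
        F x powr (1 - t) * F y powr t \<le> F ((1 - t) *\<^sub>R x + t *\<^sub>R y))"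

text \<open>Exponentiate. If \<open>p\<close> or \<open>q\<close> vanishes, both sides hold
  trivially: the weights are strictly positive, so the left sum is -\<infinity> and the product of
  powers is 0.\<close>

lemma log0_concave_iff_powr:
  assumes "0 \<le> p" "0 \<le> q" "0 \<le> r" "0 < t" "t < 1"
  shows "ereal (1 - t) * log0 p + ereal t * log0 q \<le> log0 r \<longleftrightarrow>
         p powr (1 - t) * q powr t \<le> r"
proof (cases "p = 0 \<or> q = 0")
  case True
  then show ?thesis
    using assms by (auto simp: log0_def)
next
  case False
  then have pq: "0 < p" "0 < q" using assms by auto
  have eq: "p powr (1 - t) * q powr t = exp ((1 - t) * ln p + t * ln q)"
    using pq by (simp add: powr_def exp_add)
  have pos: "0 < p powr (1 - t) * q powr t"
    using pq by simp
  show ?thesis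
  proof (cases "r = 0")
    case True
    then show ?thesis using pq pos by (simp add: log0_def not_le)
  next
    case r: False
    then have "0 < r" using assms by simp
    then have "(1 - t) * ln p + t * ln q \<le> ln r \<longleftrightarrow> exp ((1 - t) * ln p + t * ln q) \<le> r"
      by (metis exp_le_cancel_iff exp_ln)
    then show ?thesis using pq r eq by (simp add: log0_def)
  qed
qed

lemma log_concave_density_iff:
  "log_concave_density F \<longleftrightarrow> prob_density F \<and> log_concave_fun F"
proof -
  have "(\<forall>x y t. 0 < t \<and> t < 1 \<longrightarrow>
        ereal (1 - t) * log0 (F x) + ereal t * log0 (F y)
          \<le> log0 (F ((1 - t) *\<^sub>R x + t *\<^sub>R y))) \<longleftrightarrow>
     (\<forall>x y t. 0 < t \<and> t < 1 \<longrightarrow>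
        F x powr (1 - t) * F y powr t \<le> F ((1 - t) *\<^sub>R x + t *\<^sub>R y))"
    if "\<forall>x. 0 \<le> F x"
    using that by (intro all_cong1 imp_cong refl log0_concave_iff_powr) auto
  then show ?thesis
    by (auto simp: log_concave_density_def log_concave_fun_def prob_density_def)
qed

lemma log_concave_fun_nonneg: "log_concave_fun F \<Longrightarrow> 0 \<le> F x"
  by (simp add: log_concave_fun_def)

lemma log_concave_funD:
  "log_concave_fun F \<Longrightarrow> 0 < t \<Longrightarrow> t < 1 \<Longrightarrow>
   F x powr (1 - t) * F y powr t \<le> F ((1 - t) *\<^sub>R x + t *\<^sub>R y)"
  by (simp add: log_concave_fun_def)

lemma log_concave_fun_ge:
  assumes "log_concave_fun F" "0 < t" "t < 1" "0 \<le> p" "p \<le> F x" "0 \<le> q" "q \<le> F y"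
  shows "p powr (1 - t) * q powr t \<le> F ((1 - t) *\<^sub>R x + t *\<^sub>R y)"
proof -
  have "p powr (1 - t) * q powr t \<le> F x powr (1 - t) * F y powr t"
    using assms by (intro mult_mono powr_mono2) auto
  also have "\<dots> \<le> F ((1 - t) *\<^sub>R x + t *\<^sub>R y)"
    using assms by (intro log_concave_funD)
  finally show ?thesis .
qed

text \<open>Log-concavity implies quasi-concavity, since
  \<open>m powr (1 - u) * m powr u = m\<close> for positive \<open>m\<close>; for
  \<open>m \<le> 0\<close> the set is the whole space.\<close>

lemma convex_superlevel:
  fixes F :: "'a::real_vector \<Rightarrow> real"
  assumes "log_concave_fun F"
  shows "convex {x. m \<le> F x}"
proof (cases "m \<le> 0")
  case True
  then have "{x. m \<le> F x} = UNIV"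
    using assms order_trans by (auto simp: log_concave_fun_def)
  then show ?thesis by simp
next
  case False
  show ?thesis
    unfolding convex_alt
  proof safe
    fix x y and u :: real
    assume xy: "m \<le> F x" "m \<le> F y" and u: "0 \<le> u" "u \<le> 1"
    show "m \<le> F ((1 - u) *\<^sub>R x + u *\<^sub>R y)"
    proof (cases "u = 0 \<or> u = 1")
      case True then show ?thesis using xy by auto
    next
      case nt: False
      then have "m powr (1 - u) * m powr u \<le> F ((1 - u) *\<^sub>R x + u *\<^sub>R y)"
        using False xy u assms by (intro log_concave_fun_ge) auto
      then show ?thesis using False by (simp flip: powr_add)
    qed
  qed
qed

text \<open>The contraction towards \<open>y\<close> with ratio \<open>s\<close> maps
  \<open>ball z r\<close> onto the ball in question, so each \<open>x\<close> there lies between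
  \<open>y\<close> and a point \<open>w\<close> at which \<open>F\<close> is at least
  \<open>c\<close>. One value at \<open>y\<close> thus controls a whole ball.\<close>

lemma log_concave_fun_ge_ball:
  fixes F :: "'a::real_normed_vector \<Rightarrow> real"
  assumes F: "log_concave_fun F" and c: "0 \<le> c" "\<And>x. x \<in> ball z r \<Longrightarrow> c \<le> F x"
    and p: "0 \<le> p" "p \<le> F y" and s: "0 < s" "s < 1"
    and x: "x \<in> ball ((1 - s) *\<^sub>R y + s *\<^sub>R z) (s * r)"
  shows "p powr (1 - s) * c powr s \<le> F x"
proof -
  define w where "w = (1 / s) *\<^sub>R (x - (1 - s) *\<^sub>R y)"
  have x_eq: "x = (1 - s) *\<^sub>R y + s *\<^sub>R w"
    using s by (simp add: w_def)
  have "dist (s *\<^sub>R z) (s *\<^sub>R w) < s * r"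
    using x by (simp add: x_eq)
  then have "s * dist z w < s * r"
    using s by (simp flip: scaleR_diff_right add: dist_norm)
  then have "dist z w < r"
    using s by simp
  then have "c \<le> F w" using c by simp
  then show ?thesis
    unfolding x_eq using assms by (intro log_concave_fun_ge) auto
qed

text \<open>A point of \<^term>\<open>ball z r\<close> outside the perturbed hull could be separated from it, and moving
  from that point by \<^term>\<open>r\<close> along the separating normal leaves the original hull.\<close>
lemma ball_subset_perturbed_hull:
  fixes z :: "'a::euclidean_space"
  assumes T: "finite T" "cball z (2 * r) \<subseteq> convex hull T" and r: "0 < r"
    and y: "\<And>t. t \<in> T \<Longrightarrow> dist t (y t) < r"
  shows "ball z r \<subseteq> convex hull (y ` T)"
proof
  fix w assume w: "w \<in> ball z r"
  show "w \<in> convex hull (y ` T)"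
  proof (rule ccontr)
    assume nw: "w \<notin> convex hull (y ` T)"
    have "closed (convex hull (y ` T))"
      using T by (intro compact_imp_closed finite_imp_compact_convex_hull) simp
    then obtain a b where ab: "a \<bullet> w < b" "\<And>x. x \<in> convex hull (y ` T) \<Longrightarrow> b < a \<bullet> x"
      using separating_hyperplane_closed_point[OF convex_convex_hull _ nw] by blast
    have "T \<noteq> {}" using T r by force
    then obtain t where "t \<in> T" by blast
    then have "b < a \<bullet> y t" by (intro ab) (simp add: hull_inc)
    with ab(1) have a0: "a \<noteq> 0" by auto
    define v where "v = w - (r / norm a) *\<^sub>R a"
    have "dist w v = r" using r a0 by (simp add: v_def dist_norm)
    then have "dist z v \<le> 2 * r"
      using w dist_triangle[of z v w] by simp
    then have "v \<in> convex hull T" using T by auto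
    moreover have "convex hull T \<subseteq> {x. b - norm a * r < a \<bullet> x}"
    proof (rule hull_minimal)
      show "T \<subseteq> {x. b - norm a * r < a \<bullet> x}"
      proof safe
        fix t assume t: "t \<in> T"
        have "a \<bullet> (y t - t) \<le> norm a * norm (y t - t)"
          by (rule norm_cauchy_schwarz)
        also have "\<dots> \<le> norm a * r"
          using y[OF t] by (intro mult_left_mono) (auto simp: dist_norm norm_minus_commute)
        finally have "a \<bullet> y t - a \<bullet> t \<le> norm a * r" by (simp add: inner_diff_right)
        moreover have "b < a \<bullet> y t" using t by (intro ab) (simp add: hull_inc)
        ultimately show "b - norm a * r < a \<bullet> t" by simp
      qed
      show "convex {x. b - norm a * r < a \<bullet> x}"
        using convex_halfspace_gt[of "b - norm a * r" a] by simp
    qed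
    ultimately have "b - norm a * r < a \<bullet> v" by auto
    also have "a \<bullet> v = a \<bullet> w - norm a * r"
      using a0 by (simp add: v_def inner_diff_right power2_norm_eq_inner[symmetric] power2_eq_square)
    finally show False using ab by simp
  qed
qed

section \<open>Finite subsets spanning a neighbourhood of a point\<close>

lemma finite_convex_hull_subset:
  assumes "finite C" "C \<subseteq> convex hull S"
  obtains T where "finite T" "T \<subseteq> S" "C \<subseteq> convex hull T"
proof -
  have "\<exists>T. finite T \<and> T \<subseteq> S \<and> c \<in> convex hull T" if "c \<in> C" for c
  proof -
    have "c \<in> convex hull S" using that assms(2) by blast
    then obtain T u where "finite T" "T \<subseteq> S" "\<forall>x\<in>T. 0 \<le> u x" "sum u T = 1"
      "(\<Sum>v\<in>T. u v *\<^sub>R v) = c"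
      unfolding convex_hull_explicit by blast
    then have "c \<in> convex hull T"
      unfolding convex_hull_finite[OF \<open>finite T\<close>] by blast
    then show ?thesis using \<open>finite T\<close> \<open>T \<subseteq> S\<close> by blast
  qed
  then obtain T where T: "\<And>c. c \<in> C \<Longrightarrow> finite (T c) \<and> T c \<subseteq> S \<and> c \<in> convex hull (T c)"
    by metis
  show thesis
  proof
    show "finite (\<Union>(T ` C))" "\<Union>(T ` C) \<subseteq> S" using T assms by auto
    show "C \<subseteq> convex hull \<Union>(T ` C)"
      using T by (meson UN_upper hull_mono subset_iff)
  qed
qed

text \<open>A box around the point is used because it is the hull of finitely many vertices, each of
  which needs only finitely many points of \<open>S\<close>.\<close>

lemma interior_convex_hull_finite:
  fixes z :: "'a::euclidean_space"
  assumes "z \<in> interior (convex hull S)"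
  obtains T where "finite T" "T \<subseteq> S" "z \<in> interior (convex hull T)"
proof -
  obtain a b where ab: "cbox a b \<subseteq> interior (convex hull S)" "z \<in> box a b"
    using open_contains_cbox[OF open_interior assms] by metis
  obtain C where C: "finite C" "cbox a b = convex hull C"
    using polytope_interval[of a b] unfolding polytope_def by blast
  have "C \<subseteq> convex hull S"
    using ab C hull_subset[of C convex] interior_subset by blast
  then obtain T where T: "finite T" "T \<subseteq> S" "C \<subseteq> convex hull T"
    using C finite_convex_hull_subset by metis
  have "cbox a b \<subseteq> convex hull T"
    unfolding C using T by (simp add: subset_hull)
  then have "box a b \<subseteq> interior (convex hull T)"
    using box_subset_cbox by (intro interior_maximal open_box) blast
  then show thesis using T ab that by blast
qed

text \<open>\<open>T\<close> and \<open>r\<close> are fixed before \<open>F\<close> and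
  \<open>m\<close>, so one choice serves the whole sequence; and one good point in each ball is just
  what testing against bumps provides.\<close>

lemma log_concave_fun_ge_near_hull:
  fixes z :: "'a::euclidean_space"
  assumes "z \<in> interior (convex hull S)"
  obtains T r where "finite T" "T \<subseteq> S" "0 < r"
    "\<And>F m x. log_concave_fun F \<Longrightarrow> (\<And>t. t \<in> T \<Longrightarrow> \<exists>y\<in>ball t r. m \<le> F y) \<Longrightarrow>
       x \<in> ball z r \<Longrightarrow> m \<le> F x"
proof -
  obtain T where T: "finite T" "T \<subseteq> S" "z \<in> interior (convex hull T)"
    using assms by (rule interior_convex_hull_finite)
  \<comment> \<open>The radius will be \<open>e / 2\<close>, because perturbing the vertices by that
    amount costs half of the ball.\<close>
  obtain e where e: "0 < e" "cball z e \<subseteq> convex hull T"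
    using T(3) by (auto simp: mem_interior_cball)
  have "m \<le> F x" if F: "log_concave_fun F" and y: "\<And>t. t \<in> T \<Longrightarrow> \<exists>y\<in>ball t (e / 2). m \<le> F y"
    and x: "x \<in> ball z (e / 2)" for F :: "'a \<Rightarrow> real" and m x
  proof -
    obtain Y where Y: "\<And>t. t \<in> T \<Longrightarrow> Y t \<in> ball t (e / 2) \<and> m \<le> F (Y t)"
      using bchoice[of T "\<lambda>t y. y \<in> ball t (e / 2) \<and> m \<le> F y"] y by blast
    have "ball z (e / 2) \<subseteq> convex hull (Y ` T)"
      using T e Y by (intro ball_subset_perturbed_hull) auto
    moreover have "convex hull (Y ` T) \<subseteq> {x. m \<le> F x}"
      using Y by (intro hull_minimal convex_superlevel F) auto
    ultimately show ?thesis using x by auto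
  qed
  note F_ge = this
  have "0 < e / 2" using e by simp
  show thesis
    by (rule that[OF T(1,2) \<open>0 < e / 2\<close>]) (erule F_ge)
qed

text \<open>Prolonging the segment from \<open>x\<close> through \<open>y\<close> reaches a point
  where \<open>F\<close> is still at least \<open>c\<close>; log-concavity along it prevents a steep
  drop between \<open>x\<close> and \<open>y\<close>. The doubled ball leaves room for the
  prolongation.\<close>

lemma log_concave_fun_Lipschitz_at:
  fixes F :: "'a::real_normed_vector \<Rightarrow> real"
  assumes F: "log_concave_fun F" and c: "0 < c" "\<And>x. x \<in> ball z (2 * r) \<Longrightarrow> c \<le> F x"
    and M: "\<And>x. F x \<le> M" and r: "0 < r"
    and xy: "x \<in> ball z r" "y \<in> ball z r"
  shows "F x - F y \<le> M * ln (M / c) / r * norm (x - y)"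
proof (cases "x = y")
  case False
  define d where "d = norm (x - y)"
  have d: "0 < d" using False by (simp add: d_def)
  \<comment> \<open>\<open>w\<close> lies at distance \<open>r\<close> beyond \<open>y\<close>, and
    \<open>t\<close> is the weight for which
    \<open>y = (1 - t) *\<^sub>R x + t *\<^sub>R w\<close>.\<close>
  define w where "w = y + (r / d) *\<^sub>R (y - x)"
  define t where "t = d / (d + r)"
  have t: "0 < t" "t < 1" using d r by (auto simp: t_def)
  have "dist y w = r"
    using d r by (simp add: w_def dist_norm d_def norm_minus_commute)
  then have "w \<in> ball z (2 * r)"
    using xy dist_triangle[of z w y] by simp
  then have Fw: "c \<le> F w" by (rule c)
  have Fx: "c \<le> F x" "0 < F x" using xy r c(1) c(2)[of x] by auto
  have cM: "c \<le> M" using Fx M[of x] by simp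
  have "(1 - t) *\<^sub>R x + t *\<^sub>R w = (1 - t) *\<^sub>R x + (t * (1 + r / d)) *\<^sub>R y - (t * (r / d)) *\<^sub>R x"
    by (simp add: w_def algebra_simps)
  also have "t * (1 + r / d) = 1"
    using d r by (simp add: t_def divide_simps add_pos_pos)
  also have "t * (r / d) = 1 - t" using d r by (simp add: t_def field_simps)
  finally have y_eq: "y = (1 - t) *\<^sub>R x + t *\<^sub>R w" by simp
  \<comment> \<open>The inequality \<open>1 + u \<le> exp u\<close> makes the power
    \<open>(c / M) powr t\<close> linear in \<open>t\<close>, and
    \<open>t \<le> d / r\<close>.\<close>
  have "F x * (1 - t * ln (M / c)) \<le> F x * exp (- (t * ln (M / c)))"
    using Fx exp_ge_add_one_self[of "- (t * ln (M / c))"] by (intro mult_left_mono) auto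
  also have "\<dots> = F x * (c / M) powr t"
    using c cM by (simp add: powr_def ln_div algebra_simps)
  also have "\<dots> \<le> F x * (c / F x) powr t"
    using Fx c M[of x] t cM by (intro mult_left_mono powr_mono2 divide_left_mono) auto
  also have "\<dots> = F x powr (1 - t) * c powr t"
    using Fx c by (simp add: powr_divide powr_diff)
  also have "\<dots> \<le> F y"
    unfolding y_eq using F t Fx Fw c by (intro log_concave_fun_ge) auto
  finally have "F x - F y \<le> F x * (t * ln (M / c))" by (simp add: algebra_simps)
  also have "\<dots> \<le> M * (d / r * ln (M / c))"
    using M[of x] Fx t d r c cM
    by (intro mult_mono) (auto simp: t_def intro!: divide_left_mono mult_nonneg_nonneg)
  finally show ?thesis by (simp add: d_def field_simps)
qed simp

section \<open>Test integrals\<close>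

text \<open>A tent replacing the indicator of \<open>ball z r\<close>: it is positive exactly there,
  but continuous and bounded, hence admissible in \<open>conv_in_distr\<close>.\<close>

definition bump :: "'a::metric_space \<Rightarrow> real \<Rightarrow> 'a \<Rightarrow> real" where
  "bump z r x = max 0 (1 - dist x z / r)"

lemma bump_nonneg: "0 \<le> bump z r x"
  by (simp add: bump_def)

lemma bump_le_1: "0 < r \<Longrightarrow> bump z r x \<le> 1"
  by (simp add: bump_def)

lemma bump_pos_iff: "0 < r \<Longrightarrow> 0 < bump z r x \<longleftrightarrow> x \<in> ball z r"
  by (auto simp: bump_def dist_commute less_max_iff_disj)

lemma bump_eq_0: "0 < r \<Longrightarrow> x \<notin> ball z r \<Longrightarrow> bump z r x = 0"
  using bump_pos_iff[of r z x] bump_nonneg[of z r x] by simp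

lemma continuous_bump: "0 < r \<Longrightarrow> continuous_on UNIV (bump z r)"
  unfolding bump_def by (auto intro!: continuous_intros)

lemma bounded_range_bump: "0 < r \<Longrightarrow> bounded (range (bump z r))"
  using bump_nonneg[of z r] bump_le_1[of r z] by (intro boundedI[of _ 1]) (auto simp: abs_of_nonneg)

lemma borel_measurable_lebesgue_continuous:
  fixes h :: "'a::euclidean_space \<Rightarrow> real"
  shows "continuous_on UNIV h \<Longrightarrow> h \<in> borel_measurable lebesgue"
  by (intro measurable_completion) (simp add: borel_measurable_continuous_onI)

lemma integrable_continuous_mult:
  fixes h G :: "'a::euclidean_space \<Rightarrow> real"
  assumes "continuous_on UNIV h" "bounded (range h)" "integrable lebesgue G"
  shows "integrable lebesgue (\<lambda>x. h x * G x)"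
proof -
  obtain B where B: "\<And>x. \<bar>h x\<bar> \<le> B"
    using assms(2) by (auto simp: bounded_iff)
  have h: "h \<in> borel_measurable lebesgue"
    using assms(1) by (rule borel_measurable_lebesgue_continuous)
  show ?thesis
  proof (rule Bochner_Integration.integrable_bound)
    show "integrable lebesgue (\<lambda>x. B * G x)" using assms by simp
    show "(\<lambda>x. h x * G x) \<in> borel_measurable lebesgue"
      using h assms(3) by (intro borel_measurable_times) auto
    show "AE x in lebesgue. norm (h x * G x) \<le> norm (B * G x)"
    proof (rule AE_I2)
      fix x
      have "\<bar>h x\<bar> * \<bar>G x\<bar> \<le> \<bar>B\<bar> * \<bar>G x\<bar>"
        using order_trans[OF B abs_ge_self] by (intro mult_right_mono) auto
      then show "norm (h x * G x) \<le> norm (B * G x)" by (simp add: abs_mult)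
    qed
  qed
qed

lemma integrable_bump_mult:
  fixes G :: "'a::euclidean_space \<Rightarrow> real"
  assumes "0 < r" "integrable lebesgue G"
  shows "integrable lebesgue (\<lambda>x. bump z r x * G x)"
  using assms by (intro integrable_continuous_mult continuous_bump bounded_range_bump)

lemma integrable_bump:
  fixes z :: "'a::euclidean_space"
  assumes "0 < r"
  shows "integrable lebesgue (bump z r)"
proof -
  have "integrable lebesgue (\<lambda>x. bump z r x * indicat_real (ball z r) x)"
    using assms by (intro integrable_bump_mult) (auto simp: integrable_indicator_iff emeasure_lborel_ball_finite[simplified])
  also have "(\<lambda>x. bump z r x * indicat_real (ball z r) x) = bump z r"
    using bump_eq_0[OF assms] by (auto simp: indicator_def fun_eq_iff)
  finally show ?thesis .
qed

lemma integral_bump_mult_pos_iff: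
  fixes G :: "'a::euclidean_space \<Rightarrow> real"
  assumes "0 < r" "integrable lebesgue G" "\<And>x. 0 \<le> G x"
  shows "0 < (\<integral>x. bump z r x * G x \<partial>lebesgue) \<longleftrightarrow>
         \<not> (AE x in lebesgue. x \<in> ball z r \<longrightarrow> G x = 0)"
proof -
  have "(\<integral>x. bump z r x * G x \<partial>lebesgue) = 0 \<longleftrightarrow>
        (AE x in lebesgue. bump z r x * G x = 0)"
    using assms bump_nonneg[of z r]
    by (intro integral_nonneg_eq_0_iff_AE integrable_bump_mult AE_I2 mult_nonneg_nonneg) auto
  also have "(\<lambda>x. bump z r x * G x = 0) = (\<lambda>x. x \<in> ball z r \<longrightarrow> G x = 0)"
    using bump_pos_iff[OF assms(1), of z] bump_eq_0[OF assms(1), of _ z]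
    by (metis (no_types, lifting) less_irrefl mult_eq_0_iff)
  finally have "(\<integral>x. bump z r x * G x \<partial>lebesgue) = 0 \<longleftrightarrow>
        (AE x in lebesgue. x \<in> ball z r \<longrightarrow> G x = 0)" .
  moreover have "0 \<le> (\<integral>x. bump z r x * G x \<partial>lebesgue)"
    using assms bump_nonneg[of z r] by (intro Bochner_Integration.integral_nonneg mult_nonneg_nonneg) auto
  ultimately show ?thesis by linarith
qed

lemma integral_bump_pos:
  fixes z :: "'a::euclidean_space"
  assumes "0 < r"
  shows "0 < (\<integral>x. bump z r x \<partial>lebesgue)"
proof -
  have "\<not> (AE x in lebesgue. x \<notin> ball z r)"
  proof
    assume "AE x in lebesgue. x \<notin> ball z r"
    then have "ball z r \<in> null_sets lebesgue"
      by (subst AE_iff_null_sets) (auto simp: lmeasurable_ball fmeasurableD)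
    then have "negligible (ball z r)" by (simp add: negligible_iff_null_sets)
    then show False using assms open_not_negligible[of "ball z r"] by simp
  qed
  then have "\<not> (AE x in lebesgue. bump z r x = 0)"
  proof (rule contrapos_nn)
    assume "AE x in lebesgue. bump z r x = 0"
    then show "AE x in lebesgue. x \<notin> ball z r"
      by eventually_elim (use bump_pos_iff[OF assms, of z] in force)
  qed
  moreover have "(\<integral>x. bump z r x \<partial>lebesgue) = 0 \<longleftrightarrow> (AE x in lebesgue. bump z r x = 0)"
    using assms bump_nonneg[of z r] by (intro integral_nonneg_eq_0_iff_AE integrable_bump AE_I2) auto
  moreover have "0 \<le> (\<integral>x. bump z r x \<partial>lebesgue)"
    using bump_nonneg[of z r] by (intro Bochner_Integration.integral_nonneg) auto
  ultimately show ?thesis by linarith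
qed

lemma integral_bump_mult_ge:
  fixes G :: "'a::euclidean_space \<Rightarrow> real"
  assumes "0 < r" "integrable lebesgue G" "AE x in lebesgue. x \<in> ball z r \<longrightarrow> m \<le> G x"
  shows "m * (\<integral>x. bump z r x \<partial>lebesgue) \<le> (\<integral>x. bump z r x * G x \<partial>lebesgue)"
proof -
  have "(\<integral>x. bump z r x * m \<partial>lebesgue) \<le> (\<integral>x. bump z r x * G x \<partial>lebesgue)"
  proof (rule integral_mono_AE)
    show "AE x in lebesgue. bump z r x * m \<le> bump z r x * G x"
      using assms(3)
    proof eventually_elim
      case (elim x)
      then show ?case
        using bump_eq_0[OF assms(1), of x z] bump_nonneg[of z r x]
        by (cases "x \<in> ball z r") (auto intro: mult_left_mono)
    qed
  qed (use assms integrable_bump[of r z] in \<open>auto intro: integrable_bump_mult\<close>)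
  then show ?thesis by (simp add: mult.commute)
qed

lemma integral_bump_mult_le:
  fixes G :: "'a::euclidean_space \<Rightarrow> real"
  assumes "0 < r" "integrable lebesgue G" "AE x in lebesgue. x \<in> ball z r \<longrightarrow> G x \<le> m"
  shows "(\<integral>x. bump z r x * G x \<partial>lebesgue) \<le> m * (\<integral>x. bump z r x \<partial>lebesgue)"
proof -
  have "- m * (\<integral>x. bump z r x \<partial>lebesgue) \<le> (\<integral>x. bump z r x * - G x \<partial>lebesgue)"
    using assms by (intro integral_bump_mult_ge) auto
  then show ?thesis by simp
qed

section \<open>Densities and their identification by test integrals\<close>

lemma prob_densityD:
  assumes "prob_density F"
  shows "F \<in> borel_measurable lebesgue" "0 \<le> F x" "(\<integral>\<^sup>+x. ennreal (F x) \<partial>lebesgue) = 1"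
    "integrable lebesgue F" "(\<integral>x. F x \<partial>lebesgue) = 1"
proof -
  show F: "F \<in> borel_measurable lebesgue" and nn: "0 \<le> F x" for x
    using assms by (auto simp: prob_density_def)
  interpret prob_space "density lebesgue (\<lambda>x. ennreal (F x))"
    using assms by (simp add: prob_density_def)
  show *: "(\<integral>\<^sup>+x. ennreal (F x) \<partial>lebesgue) = 1"
    using emeasure_space_1 F by (simp add: emeasure_density)
  show "integrable lebesgue F"
    using F nn * by (intro integrableI_nonneg) auto
  show "(\<integral>x. F x \<partial>lebesgue) = 1"
    using F nn * by (subst integral_eq_nn_integral) auto
qed

lemma prob_densityI:
  assumes "F \<in> borel_measurable lebesgue" "\<And>x. 0 \<le> F x" "(\<integral>\<^sup>+x. ennreal (F x) \<partial>lebesgue) = 1"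
  shows "prob_density F"
  using assms by (auto simp: prob_density_def emeasure_density intro!: prob_spaceI)

text \<open>The distance to a closed complement is positive exactly on \<open>B\<close>. The
  complement has to be nonempty because \<open>infdist\<close> to the empty set is 0 by
  convention.\<close>

lemma tendsto_plateau:
  fixes x :: "'a::metric_space"
  assumes "open B" "- B \<noteq> {}"
  shows "(\<lambda>k. min 1 (real k * infdist x (- B))) \<longlonglongrightarrow> indicat_real B x"
proof (cases "x \<in> B")
  case True
  then have "0 < infdist x (- B)"
    using assms by (auto simp: infdist_pos_not_in_closed closed_Compl)
  then obtain K :: nat where K: "1 \<le> real K * infdist x (- B)"
    using reals_Archimedean3[of "infdist x (- B)"] less_imp_le by blast
  have "eventually (\<lambda>k. min 1 (real k * infdist x (- B)) = 1) sequentially"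
    using eventually_ge_at_top[of K]
  proof eventually_elim
    case (elim k)
    then have "real K * infdist x (- B) \<le> real k * infdist x (- B)"
      by (intro mult_right_mono infdist_nonneg) auto
    then show ?case using K by simp
  qed
  then show ?thesis using True by (simp add: tendsto_eventually)
next
  case False
  then show ?thesis by (simp add: infdist_zero)
qed

lemma set_integral_eq_if_test_integrals_eq:
  fixes f g :: "'a::euclidean_space \<Rightarrow> real"
  assumes f: "integrable lebesgue f" and g: "integrable lebesgue g"
    and eq: "\<And>h R. continuous_on UNIV h \<Longrightarrow> (\<And>x. 0 \<le> h x) \<Longrightarrow> (\<And>x. h x \<le> 1) \<Longrightarrow>
       (\<And>x. x \<notin> cball 0 R \<Longrightarrow> h x = 0) \<Longrightarrow>
       (\<integral>x. h x * f x \<partial>lebesgue) = (\<integral>x. h x * g x \<partial>lebesgue)"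
    and B: "open B" "bounded B"
  shows "(\<integral>x. indicator B x * f x \<partial>lebesgue) = (\<integral>x. indicator B x * g x \<partial>lebesgue)"
proof -
  define h where "h k x = min 1 (real k * infdist x (- B))" for k and x :: 'a
  have nB: "- B \<noteq> {}" using B(2) not_bounded_UNIV by (metis Compl_empty_eq double_complement)
  have h: "continuous_on UNIV (h k)" "0 \<le> h k x" "h k x \<le> 1" for k x
    unfolding h_def by (auto intro!: continuous_intros simp: infdist_nonneg)
  have h_lim: "(\<lambda>k. h k x) \<longlonglongrightarrow> indicat_real B x" for x
    unfolding h_def by (intro tendsto_plateau B nB)
  have lim: "(\<lambda>k. \<integral>x. h k x * u x \<partial>lebesgue) \<longlonglongrightarrow> (\<integral>x. indicator B x * u x \<partial>lebesgue)"
    if u: "integrable lebesgue u" for u :: "'a \<Rightarrow> real"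
  proof (rule integral_dominated_convergence[where w = "\<lambda>x. \<bar>u x\<bar>"])
    have um: "u \<in> borel_measurable lebesgue" using u by auto
    have "B \<in> sets lebesgue" using B by (simp add: borel_open)
    then show "(\<lambda>x. indicat_real B x * u x) \<in> borel_measurable lebesgue"
      using um by measurable
    show "(\<lambda>x. h k x * u x) \<in> borel_measurable lebesgue" for k
      using um borel_measurable_lebesgue_continuous[OF h(1)] by (rule borel_measurable_times[rotated])
    show "integrable lebesgue (\<lambda>x. \<bar>u x\<bar>)" using u by simp
    show "AE x in lebesgue. (\<lambda>k. h k x * u x) \<longlonglongrightarrow> indicat_real B x * u x"
      using h_lim by (intro AE_I2 tendsto_mult) auto
    show "AE x in lebesgue. norm (h k x * u x) \<le> \<bar>u x\<bar>" for k
      using h by (intro AE_I2) (auto simp: abs_mult intro: mult_left_le_one_le)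
  qed
  obtain R where R: "B \<subseteq> cball 0 R"
    using bounded_subset_ballD[OF B(2), of 0] ball_subset_cball by blast
  have "(\<integral>x. h k x * f x \<partial>lebesgue) = (\<integral>x. h k x * g x \<partial>lebesgue)" for k
  proof (rule eq[of _ R])
    show "h k x = 0" if "x \<notin> cball 0 R" for x
    proof -
      have "x \<in> - B" using that R by blast
      then show ?thesis by (simp add: h_def)
    qed
  qed (use h in auto)
  then show ?thesis
    using LIMSEQ_unique[OF lim[OF f]] lim[OF g] by simp
qed

text \<open>The two measures agree on open boxes, an intersection-stable generator of the Borel
  sets, so their densities agree almost everywhere.\<close>

lemma AE_eq_if_test_integrals_eq:
  fixes f g :: "'a::euclidean_space \<Rightarrow> real"
  assumes f: "integrable lebesgue f" "\<And>x. 0 \<le> f x" and g: "integrable lebesgue g" "\<And>x. 0 \<le> g x"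
    and eq: "\<And>h R. continuous_on UNIV h \<Longrightarrow> (\<And>x. 0 \<le> h x) \<Longrightarrow> (\<And>x. h x \<le> 1) \<Longrightarrow>
       (\<And>x. x \<notin> cball 0 R \<Longrightarrow> h x = 0) \<Longrightarrow>
       (\<integral>x. h x * f x \<partial>lebesgue) = (\<integral>x. h x * g x \<partial>lebesgue)"
  shows "AE x in lebesgue. f x = g x"
proof -
  \<comment> \<open>Boxes generate the Borel sets, not the Lebesgue sets; both functions are
    therefore exchanged for Borel versions, and the comparison takes place over
    \<open>lborel\<close>.\<close>
  have rep: "\<exists>u'\<in>borel_measurable lborel. AE x in lborel. ennreal (u x) = u' x"
    if "integrable lebesgue u" for u :: "'a \<Rightarrow> real"
    using that completion_ex_borel_measurable[of "\<lambda>x. ennreal (u x)" lborel] by auto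
  obtain f' where f': "f' \<in> borel_measurable lborel" "AE x in lborel. ennreal (f x) = f' x"
    using rep[OF f(1)] by blast
  obtain g' where g': "g' \<in> borel_measurable lborel" "AE x in lborel. ennreal (g x) = g' x"
    using rep[OF g(1)] by blast
  have em: "emeasure (density lborel u') B = ennreal (\<integral>x. indicator B x * u x \<partial>lebesgue)"
    if u: "integrable lebesgue u" "\<And>x. 0 \<le> u x"
      and u': "u' \<in> borel_measurable lborel" "AE x in lborel. ennreal (u x) = u' x"
      and B: "open B" for u u' and B :: "'a set"
  proof -
    have Bl: "B \<in> sets lebesgue" using B by (simp add: borel_open)
    have "emeasure (density lborel u') B = (\<integral>\<^sup>+x. u' x * indicator B x \<partial>lborel)"
      using u' B by (intro emeasure_density) auto
    also have "\<dots> = (\<integral>\<^sup>+x. u' x * indicator B x \<partial>lebesgue)"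
      using u' B by (intro nn_integral_completion[symmetric])
    also have "\<dots> = (\<integral>\<^sup>+x. ennreal (indicator B x * u x) \<partial>lebesgue)"
      using AE_completion[OF u'(2)]
      by (intro nn_integral_cong_AE) (auto elim!: eventually_mono simp: indicator_def)
    also have "\<dots> = ennreal (\<integral>x. indicator B x * u x \<partial>lebesgue)"
      using u Bl by (intro nn_integral_eq_integral) (auto intro: integrable_mult_indicator[of B lebesgue u, simplified])
    finally show ?thesis .
  qed
  have "density lborel f' = density lborel g'"
  proof (rule measure_eqI_generator_eq)
    let ?E = "range (\<lambda>(a, b). box a b::'a set)"
    show "Int_stable ?E"
      by (auto simp: Int_stable_def box_Int_box)
    show "?E \<subseteq> Pow UNIV" "sets (density lborel f') = sigma_sets UNIV ?E"
      "sets (density lborel g') = sigma_sets UNIV ?E"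
      by (simp_all add: borel_eq_box)
    let ?A = "\<lambda>n::nat. box (- (real n *\<^sub>R One)) (real n *\<^sub>R One) :: 'a set"
    show "range ?A \<subseteq> ?E" "(\<Union>i. ?A i) = UNIV"
      unfolding UN_box_eq_UNIV by auto
    show "emeasure (density lborel f') (?A i) \<noteq> \<infinity>" for i
      using em[OF f f', of "?A i"] by (simp add: open_box)
    show "emeasure (density lborel f') X = emeasure (density lborel g') X" if "X \<in> ?E" for X
    proof -
      have X: "open X" "bounded X" using that by (auto simp: open_box bounded_box)
      have "(\<integral>x. indicator X x * f x \<partial>lebesgue) = (\<integral>x. indicator X x * g x \<partial>lebesgue)"
        by (rule set_integral_eq_if_test_integrals_eq[OF f(1) g(1) eq X])
      then show ?thesis
        unfolding em[OF f f' X(1)] em[OF g g' X(1)] by (rule arg_cong)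
    qed
  qed
  then have "AE x in lborel. f' x = g' x"
    using f' g' by (intro sigma_finite_measure.density_unique[OF sigma_finite_lborel])
  with f'(2) g'(2) have "AE x in lborel. f x = g x"
    by eventually_elim (simp add: f(2) g(2) flip: ennreal_inj)
  then show ?thesis by (rule AE_completion)
qed

section \<open>Integrability of exponentials of the norm\<close>

lemma summable_power_times_exp:
  fixes e :: real
  assumes "0 < e"
  shows "summable (\<lambda>k. exp (- e * real k) * (real k + 1) ^ d)"
proof (rule summable_comparison_test_bigo)
  \<comment> \<open>Half of the rate \<open>e\<close> absorbs the polynomial factor, the other half
    leaves a geometric series.\<close>
  show "summable (\<lambda>k. norm (exp (- e / 2) ^ k))"
    using assms by (simp add: summable_geometric)
  have lim: "(\<lambda>k. (real k + 1) ^ d * exp (- e / 2 * real k)) \<longlonglongrightarrow> 0"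
  proof -
    \<comment> \<open>The constant undoes the substitution \<open>x = e / 2 * (real k + 1)\<close>
      made below.\<close>
    have "((\<lambda>x. (x ^ d / exp x) * ((2 / e) ^ d * exp (e / 2))) \<longlongrightarrow> 0 * ((2 / e) ^ d * exp (e / 2))) at_top"
      by (intro tendsto_mult tendsto_power_div_exp_0 tendsto_const)
    moreover have "filterlim (\<lambda>k. e / 2 * (real k + 1)) at_top sequentially"
      using assms by (subst add.commute) (intro filterlim_tendsto_pos_mult_at_top[OF tendsto_const]
          filterlim_tendsto_add_at_top[OF tendsto_const] filterlim_real_sequentially; simp)
    ultimately have "((\<lambda>k. ((e / 2 * (real k + 1)) ^ d / exp (e / 2 * (real k + 1))) * ((2 / e) ^ d * exp (e / 2)))
       \<longlongrightarrow> 0 * ((2 / e) ^ d * exp (e / 2))) sequentially"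
      by (rule filterlim_compose)
    moreover have "((e / 2 * (real k + 1)) ^ d / exp (e / 2 * (real k + 1))) * ((2 / e) ^ d * exp (e / 2))
        = (real k + 1) ^ d * exp (- e / 2 * real k)" for k
    proof -
      have "(e / 2 * (real k + 1)) ^ d * (2 / e) ^ d = (real k + 1) ^ d"
        using assms by (simp flip: power_mult_distrib)
      moreover have "exp (e / 2) / exp (e / 2 * (real k + 1)) = exp (- e / 2 * real k)"
        by (simp add: exp_diff[symmetric] algebra_simps)
      moreover have "p / E * (q * G) = (p * q) * (G / E)" for p q E G :: real
        by simp
      ultimately show ?thesis by presburger
    qed
    ultimately show ?thesis by simp
  qed
  show "(\<lambda>k. exp (- e * real k) * (real k + 1) ^ d) \<in> O(\<lambda>k. exp (- e / 2) ^ k)"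
  proof (rule landau_o.small_imp_big, rule smalloI_tendsto)
    have "exp (- e * real k) * (real k + 1) ^ d / exp (- e / 2) ^ k
        = (real k + 1) ^ d * exp (- e / 2 * real k)" for k
    proof -
      have "exp (- e / 2) ^ k = exp (- e / 2 * real k)"
        by (simp add: exp_of_nat_mult[symmetric] mult.commute)
      moreover have "exp (- e * real k) = exp (- e / 2 * real k) * exp (- e / 2 * real k)"
        by (simp add: exp_add[symmetric])
      ultimately show ?thesis by simp
    qed
    then show "(\<lambda>k. exp (- e * real k) * (real k + 1) ^ d / exp (- e / 2) ^ k) \<longlonglongrightarrow> 0"
      using lim by simp
  qed simp
qed

text \<open>Splits the space into shells on which the norm lies between consecutive integers.\<close>
lemma nn_integral_exp_neg_norm_finite:
  fixes e :: real
  assumes "0 < e"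
  shows "(\<integral>\<^sup>+x. ennreal (exp (- e * norm (x :: 'a::euclidean_space))) \<partial>lebesgue) < \<infinity>"
proof -
  define V where "V = measure lebesgue (ball (0::'a) 1)"
  have "(\<integral>\<^sup>+x. ennreal (exp (- e * norm (x :: 'a))) \<partial>lebesgue) \<le>
     (\<integral>\<^sup>+x. (\<Sum>k. ennreal (exp (- e * real k)) * indicator (ball (0::'a) (real k + 1)) x) \<partial>lebesgue)"
  proof (rule nn_integral_mono)
    fix x :: 'a
    \<comment> \<open>The single term at the integer part of the norm already dominates. Full balls
      instead of shells only enlarge the sum, and their volumes scale explicitly.\<close>
    define k where "k = nat \<lfloor>norm x\<rfloor>"
    have k: "real k \<le> norm x" "norm x < real k + 1"
      unfolding k_def by (simp_all add: of_nat_nat floor_less_iff[symmetric])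
    define a where "a j = ennreal (exp (- e * real j)) * indicator (ball 0 (real j + 1)) x" for j
    have "ennreal (exp (- e * norm x)) \<le> a k"
      using k assms by (simp add: a_def)
    also have "a k \<le> suminf a"
      using sum_le_suminf[of a "{k}"] by simp
    finally show "ennreal (exp (- e * norm x)) \<le> (\<Sum>k. ennreal (exp (- e * real k)) * indicator (ball 0 (real k + 1)) x)"
      unfolding a_def .
  qed
  also have "\<dots> = (\<Sum>k. ennreal (exp (- e * real k)) * emeasure lebesgue (ball (0::'a) (real k + 1)))"
  proof -
    have "ball (0::'a) (real k + 1) \<in> sets lebesgue" for k :: nat by (simp add: borel_open)
    then show ?thesis
      by (subst nn_integral_suminf) (simp_all only: nn_integral_cmult_indicator borel_measurable_indicator
          borel_measurable_times_ennreal borel_measurable_const)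
  qed
  also have "\<dots> = (\<Sum>k. ennreal (exp (- e * real k) * (real k + 1) ^ DIM('a) * V))"
  proof (rule suminf_cong)
    fix k :: nat
    have "emeasure lebesgue (ball (0::'a) (real k + 1)) = ennreal (measure lebesgue (ball (0::'a) (real k + 1)))"
      using emeasure_lborel_ball_finite[of "0::'a" "real k + 1"]
      by (subst emeasure_eq_ennreal_measure) auto
    also have "measure lebesgue (ball (0::'a) (real k + 1)) = (real k + 1) ^ DIM('a) * V"
      unfolding V_def
      using content_ball_conv_unit_ball[of "real k + 1" "0::'a"] by (simp add: measure_completion)
    finally show "ennreal (exp (- e * real k)) * emeasure lebesgue (ball (0::'a) (real k + 1)) =
       ennreal (exp (- e * real k) * (real k + 1) ^ DIM('a) * V)"
      by (simp add: ennreal_mult V_def mult.assoc)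
  qed
  also have "\<dots> < \<infinity>"
  proof -
    have "summable (\<lambda>k. exp (- e * real k) * (real k + 1) ^ DIM('a) * V)"
      using assms by (intro summable_mult2 summable_power_times_exp)
    then show ?thesis
      by (subst suminf_ennreal2) (auto simp: V_def)
  qed
  finally show ?thesis .
qed

section \<open>Weak limits of log-concave densities\<close>

lemma prob_density_ge_ball_le:
  fixes F :: "'a::euclidean_space \<Rightarrow> real"
  assumes F: "prob_density F" and m: "0 \<le> m" "\<And>x. x \<in> ball w r \<Longrightarrow> m \<le> F x"
  shows "m * measure lebesgue (ball w r) \<le> 1"
proof -
  have "(\<integral>x. m * indicat_real (ball w r) x \<partial>lebesgue) \<le> (\<integral>x. F x \<partial>lebesgue)"
  proof (rule integral_mono)
    show "integrable lebesgue (\<lambda>x. m * indicat_real (ball w r) x)"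
      by (auto simp: integrable_indicator_iff emeasure_lborel_ball_finite[simplified])
    show "integrable lebesgue F" using prob_densityD[OF F] by simp
    show "m * indicat_real (ball w r) x \<le> F x" for x
      using m prob_densityD(2)[OF F] by (auto simp: indicator_def)
  qed
  then show ?thesis using prob_densityD[OF F] by simp
qed

text \<open>A finite subcover leaves finitely many eventual statements to be combined.\<close>

lemma eventually_compact:
  fixes Q :: "'a::metric_space set"
  assumes "compact Q"
    and loc: "\<And>y. y \<in> Q \<Longrightarrow> \<exists>\<delta>>0. \<forall>\<^sub>F n in F. \<forall>y'\<in>ball y \<delta>. P n y'"
  shows "\<forall>\<^sub>F n in F. \<forall>y\<in>Q. P n y"
proof -
  obtain \<delta> where \<delta>: "\<And>y. y \<in> Q \<Longrightarrow> 0 < \<delta> y \<and> (\<forall>\<^sub>F n in F. \<forall>y'\<in>ball y (\<delta> y). P n y')"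
    using loc by metis
  have "Q \<subseteq> (\<Union>y\<in>Q. ball y (\<delta> y))"
    using \<delta> by (meson UN_I centre_in_ball subsetI)
  then obtain C where C: "C \<subseteq> Q" "finite C" "Q \<subseteq> (\<Union>y\<in>C. ball y (\<delta> y))"
    by (rule compactE_image[OF assms(1) open_ball])
  have "\<forall>\<^sub>F n in F. \<forall>y\<in>C. \<forall>y'\<in>ball y (\<delta> y). P n y'"
    using C \<delta> by (intro eventually_ball_finite) auto
  then show ?thesis
    by eventually_elim (use C in blast)
qed

text \<open>\<open>A\<close> may depend on \<open>e\<close>, so no candidate for the limit is
  needed: it will be an average of \<open>f\<close> over a ball whose size varies with
  \<open>e\<close>.\<close>

lemma convergent_if_eventually_close:
  fixes X :: "nat \<Rightarrow> real"
  assumes "\<And>e. 0 < e \<Longrightarrow> \<exists>A. \<forall>\<^sub>F n in sequentially. \<bar>X n - A\<bar> < e"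
  shows "convergent X"
proof -
  have "Cauchy X"
  proof (rule CauchyI)
    fix e :: real assume "0 < e"
    then obtain A N where A: "\<And>n. N \<le> n \<Longrightarrow> \<bar>X n - A\<bar> < e / 2"
      using assms[of "e / 2"] by (auto simp: eventually_sequentially)
    have "norm (X m - X n) < e" if "N \<le> m" "N \<le> n" for m n
      using A[OF that(1)] A[OF that(2)] by (simp add: abs_if split: if_splits)
    then show "\<exists>M. \<forall>m\<ge>M. \<forall>n\<ge>M. norm (X m - X n) < e" by blast
  qed
  then show ?thesis by (rule Cauchy_convergent)
qed

locale log_concave_weak_limit =
  fixes fs :: "nat \<Rightarrow> 'a::euclidean_space \<Rightarrow> real" and f :: "'a \<Rightarrow> real"
  assumes log_concave: "\<And>n. log_concave_density (fs n)"
    and limit_density: "prob_density f"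
    and conv: "conv_in_distr fs f"
begin

section \<open>Bump averages along the sequence\<close>

lemma prob_density_fs: "prob_density (fs n)" and log_concave_fs: "log_concave_fun (fs n)"
  using log_concave by (auto simp: log_concave_density_iff)

lemmas fs_simps [simp] = prob_densityD[OF prob_density_fs]
lemmas f_simps [simp] = prob_densityD[OF limit_density]

lemma tendsto_bump:
  "0 < r \<Longrightarrow> (\<lambda>n. \<integral>x. bump z r x * fs n x \<partial>lebesgue) \<longlonglongrightarrow> (\<integral>x. bump z r x * f x \<partial>lebesgue)"
  using conv continuous_bump bounded_range_bump unfolding conv_in_distr_def by blast

lemma eventually_ex_ge:
  assumes "0 < r" "m * (\<integral>x. bump z r x \<partial>lebesgue) < (\<integral>x. bump z r x * f x \<partial>lebesgue)"
  shows "\<forall>\<^sub>F n in sequentially. \<exists>y\<in>ball z r. m \<le> fs n y"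
  using order_tendstoD(1)[OF tendsto_bump[OF assms(1)] assms(2)]
proof eventually_elim
  case (elim n)
  show ?case
  proof (rule ccontr)
    assume "\<not> ?case"
    then have "(\<integral>x. bump z r x * fs n x \<partial>lebesgue) \<le> m * (\<integral>x. bump z r x \<partial>lebesgue)"
      using assms(1) by (intro integral_bump_mult_le AE_I2) (auto simp: not_le less_imp_le)
    with elim show False by simp
  qed
qed

lemma eventually_ex_less:
  assumes "0 < r" "(\<integral>x. bump z r x * f x \<partial>lebesgue) < m * (\<integral>x. bump z r x \<partial>lebesgue)"
  shows "\<forall>\<^sub>F n in sequentially. \<exists>y\<in>ball z r. fs n y < m"
  using order_tendstoD(2)[OF tendsto_bump[OF assms(1)] assms(2)]
proof eventually_elim
  case (elim n)
  show ?case
  proof (rule ccontr)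
    assume "\<not> ?case"
    then have "m * (\<integral>x. bump z r x \<partial>lebesgue) \<le> (\<integral>x. bump z r x * fs n x \<partial>lebesgue)"
      using assms(1) by (intro integral_bump_mult_ge AE_I2) (auto simp: not_less)
    with elim show False by simp
  qed
qed

text \<open>The topological support of the measure with density \<open>f\<close>. Unlike the set
  where \<open>f\<close> is nonzero, it is unaffected by changes on null sets.\<close>

definition supp :: "'a set" where
  "supp = {z. \<forall>r>0. 0 < (\<integral>x. bump z r x * f x \<partial>lebesgue)}"

definition hull_interior :: "'a set" where
  "hull_interior = interior (convex hull supp)"

lemma open_hull_interior: "open hull_interior" and convex_hull_interior: "convex hull_interior"
  by (auto simp: hull_interior_def convex_interior convex_convex_hull)

text \<open>The complement is covered by balls on which \<open>f\<close> vanishes almost everywhere;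
  Lindelof's theorem makes the cover countable, so the exceptional null sets add up to a null
  set.\<close>

lemma AE_zero_off_supp: "AE x in lebesgue. x \<notin> supp \<longrightarrow> f x = 0"
proof -
  have "\<exists>r>0. AE x in lebesgue. x \<in> ball z r \<longrightarrow> f x = 0" if "z \<notin> supp" for z
    using that integral_bump_mult_pos_iff[of _ f z] by (auto simp: supp_def)
  then obtain r where r: "\<And>z. z \<notin> supp \<Longrightarrow> 0 < r z \<and> (AE x in lebesgue. x \<in> ball z (r z) \<longrightarrow> f x = 0)"
    by metis
  obtain \<C> where C: "\<C> \<subseteq> (\<lambda>z. ball z (r z)) ` (- supp)" "countable \<C>"
    "\<Union>\<C> = \<Union>((\<lambda>z. ball z (r z)) ` (- supp))"
    using Lindelof[of "(\<lambda>z. ball z (r z)) ` (- supp)"] by blast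
  have "AE x in lebesgue. x \<in> C \<longrightarrow> f x = 0" if "C \<in> \<C>" for C
    using that C r by force
  then have "AE x in lebesgue. \<forall>C\<in>\<C>. x \<in> C \<longrightarrow> f x = 0"
    by (subst AE_ball_countable[OF C(2)]) blast
  moreover have "- supp \<subseteq> \<Union>\<C>"
    using r C(3) by force
  ultimately show ?thesis
    by (auto elim!: eventually_mono)
qed

text \<open>A convex set without interior is null, and then \<open>f\<close> would have total mass
  0.\<close>

lemma hull_interior_nonempty: "hull_interior \<noteq> {}"
proof
  assume "hull_interior = {}"
  then have "negligible (convex hull supp)"
    by (simp add: negligible_convex_interior convex_convex_hull hull_interior_def)
  then have "convex hull supp \<in> null_sets lebesgue"
    by (simp add: negligible_iff_null_sets)
  then have "AE x in lebesgue. x \<notin> convex hull supp"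
    by (rule AE_not_in)
  with AE_zero_off_supp have "AE x in lebesgue. f x = 0"
    by eventually_elim (use hull_subset in fast)
  then have "(\<integral>x. f x \<partial>lebesgue) = (\<integral>x. 0 \<partial>(lebesgue :: 'a measure))"
    by (intro integral_cong_AE) auto
  then show False by simp
qed

text \<open>Each of the finitely many support points has a positive bump integral of
  \<open>f\<close>, so a single small \<open>c\<close> lies below all the corresponding
  averages.\<close>

lemma eventually_ge_near:
  assumes "z \<in> hull_interior"
  obtains c r where "0 < c" "0 < r" "\<forall>\<^sub>F n in sequentially. \<forall>x\<in>ball z r. c \<le> fs n x"
proof -
  obtain T r where T: "finite T" "T \<subseteq> supp" "0 < r"
    "\<And>F m x. log_concave_fun F \<Longrightarrow> (\<And>t. t \<in> T \<Longrightarrow> \<exists>y\<in>ball t r. m \<le> F y) \<Longrightarrow>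
       x \<in> ball z r \<Longrightarrow> m \<le> F x"
    using log_concave_fun_ge_near_hull[of z supp] assms unfolding hull_interior_def by blast
  have "\<forall>\<^sub>F c in at_right 0. \<forall>t\<in>T. c * (\<integral>x. bump t r x \<partial>lebesgue) < (\<integral>x. bump t r x * f x \<partial>lebesgue)"
  proof (intro eventually_ball_finite T ballI)
    fix t assume "t \<in> T"
    then have "0 < (\<integral>x. bump t r x * f x \<partial>lebesgue)"
      using T by (auto simp: supp_def)
    moreover have "((\<lambda>c. c * (\<integral>x. bump t r x \<partial>lebesgue)) \<longlongrightarrow> 0 * (\<integral>x. bump t r x \<partial>lebesgue)) (at_right 0)"
      by (intro tendsto_intros)
    ultimately show "\<forall>\<^sub>F c in at_right 0. c * (\<integral>x. bump t r x \<partial>lebesgue) < (\<integral>x. bump t r x * f x \<partial>lebesgue)"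
      by (intro order_tendstoD) simp_all
  qed
  moreover have "\<forall>\<^sub>F c in at_right 0. (0::real) < c"
    by (simp add: eventually_at_right_less)
  ultimately have "\<forall>\<^sub>F c in at_right 0. 0 < c \<and>
      (\<forall>t\<in>T. c * (\<integral>x. bump t r x \<partial>lebesgue) < (\<integral>x. bump t r x * f x \<partial>lebesgue))"
    by eventually_elim simp
  then obtain c where c: "0 < c"
    "\<And>t. t \<in> T \<Longrightarrow> c * (\<integral>x. bump t r x \<partial>lebesgue) < (\<integral>x. bump t r x * f x \<partial>lebesgue)"
    using eventually_happens[of _ "at_right (0::real)"] trivial_limit_at_right_real by blast
  have "\<forall>\<^sub>F n in sequentially. \<forall>t\<in>T. \<exists>y\<in>ball t r. c \<le> fs n y"
    using c T by (intro eventually_ball_finite ballI eventually_ex_ge) auto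
  then have "\<forall>\<^sub>F n in sequentially. \<forall>x\<in>ball z r. c \<le> fs n x"
    by eventually_elim (use T(4)[OF log_concave_fs] in blast)
  then show thesis using c T that by blast
qed

text \<open>A large value at \<^term>\<open>y\<close> would, by log-concavity, be felt on the ball of half the radius
  around the midpoint of \<^term>\<open>y\<close> and a point near which the densities are bounded below.\<close>
lemma eventually_bounded:
  obtains M where "0 < M" "\<forall>\<^sub>F n in sequentially. \<forall>x. fs n x \<le> M"
proof -
  obtain z where "z \<in> hull_interior" using hull_interior_nonempty by blast
  then obtain c r where c: "0 < c" "0 < r" "\<forall>\<^sub>F n in sequentially. \<forall>x\<in>ball z r. c \<le> fs n x"
    by (rule eventually_ge_near)
  define V where "V = measure lebesgue (ball (0::'a) (r / 2))"
  have V: "measure lebesgue (ball w (r / 2)) = V" for w :: 'a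
    unfolding V_def using c
      content_ball_conv_unit_ball[of "r / 2" w] content_ball_conv_unit_ball[of "r / 2" "0::'a"]
    by (simp add: measure_completion)
  have V0: "0 < V"
    using c content_ball_pos[of "r / 2" "0::'a"] by (simp add: V_def measure_completion)
  have "\<forall>\<^sub>F n in sequentially. \<forall>y. fs n y \<le> 1 / (c * V\<^sup>2)"
    using c(3)
  proof (rule eventually_mono, intro allI)
    fix n y assume elim: "\<forall>x\<in>ball z r. c \<le> fs n x"
    have "fs n y powr (1 - 1 / 2) * c powr (1 / 2) \<le> fs n x"
      if "x \<in> ball ((1 - 1 / 2) *\<^sub>R y + (1 / 2) *\<^sub>R z) (1 / 2 * r)" for x
      using elim c by (intro log_concave_fun_ge_ball[OF log_concave_fs _ _ _ order_refl _ _ that]) auto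
    then have "fs n y powr (1 - 1 / 2) * c powr (1 / 2) *
        measure lebesgue (ball ((1 - 1 / 2) *\<^sub>R y + (1 / 2) *\<^sub>R z) (1 / 2 * r)) \<le> 1"
      by (intro prob_density_ge_ball_le[OF prob_density_fs[of n]]) auto
    \<comment> \<open>The geometric mean of the two values holds on a ball of volume
      \<open>V\<close>, and the total mass is 1; squaring gives the constant
      \<open>1 / (c * V\<^sup>2)\<close>.\<close>
    then have "sqrt (fs n y * c) * V \<le> 1"
      using c V by (simp add: powr_half_sqrt real_sqrt_mult)
    then have "(sqrt (fs n y * c) * V)\<^sup>2 \<le> 1"
      using c V0 by (simp add: power_le_one)
    then show "fs n y \<le> 1 / (c * V\<^sup>2)"
      using c V0 by (simp add: power_mult_distrib field_simps)
  qed
  then show thesis using c V0 by (intro that[of "1 / (c * V\<^sup>2)"]) auto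
qed

text \<open>Contracting towards a point near which the densities are bounded below moves a large value
  into the interior, where it is visible to test functions.\<close>
lemma eventually_less_near:
  assumes \<rho>: "0 < \<rho>" and f_le: "AE x in lebesgue. x \<in> ball y \<rho> \<longrightarrow> f x \<le> u"
    and u: "0 \<le> u" "u < \<eta>"
  shows "\<exists>\<delta>>0. \<forall>\<^sub>F n in sequentially. \<forall>y'\<in>ball y \<delta>. fs n y' < \<eta>"
proof -
  obtain z where "z \<in> hull_interior" using hull_interior_nonempty by blast
  then obtain c r where c: "0 < c" "0 < r" "\<forall>\<^sub>F n in sequentially. \<forall>x\<in>ball z r. c \<le> fs n x"
    by (rule eventually_ge_near)
  have \<eta>: "0 < \<eta>" using u by simp
  \<comment> \<open>The contraction parameter \<open>s\<close> is small for two reasons: the value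
    that a height \<eta> near \<open>y\<close> would force must still exceed \<open>u\<close>, and
    the contracted ball must stay inside \<open>ball y \<rho>\<close>.\<close>
  have "((\<lambda>s. \<eta> powr (1 - s) * c powr s) \<longlongrightarrow> \<eta> powr (1 - 0) * c powr 0) (at_right 0)"
    using \<eta> c by (intro tendsto_intros) auto
  then have "\<forall>\<^sub>F s in at_right 0. u < \<eta> powr (1 - s) * c powr s"
    using \<eta> c u by (intro order_tendstoD) auto
  moreover have "((\<lambda>s. s * (dist y z + r)) \<longlongrightarrow> 0 * (dist y z + r)) (at_right 0)"
    by (intro tendsto_intros)
  then have "\<forall>\<^sub>F s in at_right 0. s * (dist y z + r) < \<rho>"
    using \<rho> by (intro order_tendstoD) auto
  moreover have "\<forall>\<^sub>F s in at_right 0. s \<in> {0<..<1::real}"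
    by (rule eventually_at_right_real) simp
  ultimately have "\<forall>\<^sub>F s in at_right 0. u < \<eta> powr (1 - s) * c powr s \<and> s * (dist y z + r) < \<rho>
      \<and> s \<in> {0<..<1}"
    by eventually_elim simp
  then obtain s where s: "u < \<eta> powr (1 - s) * c powr s" "s * (dist y z + r) < \<rho>" "0 < s" "s < 1"
    using eventually_happens[of _ "at_right (0::real)"] trivial_limit_at_right_real by fastforce
  define m where "m = \<eta> powr (1 - s) * c powr s"
  define w where "w = (1 - s) *\<^sub>R y + s *\<^sub>R z"
  \<comment> \<open>Half of the available radius \<open>s * r\<close> goes to the displacement of
    \<open>y'\<close> from \<open>y\<close>, half to that of \<open>x\<close> from
    \<open>w\<close>.\<close>
  define \<delta> where "\<delta> = s * r / 2"
  have \<delta>: "0 < \<delta>" using s c by (simp add: \<delta>_def)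
  have "y - w = s *\<^sub>R (y - z)" by (simp add: w_def algebra_simps)
  then have yw: "dist y w = s * dist y z" using s by (simp add: dist_norm)
  have sub: "ball w \<delta> \<subseteq> ball y \<rho>"
  proof
    fix x assume "x \<in> ball w \<delta>"
    then have "dist y x < s * dist y z + \<delta>"
      using dist_triangle[of y x w] yw by simp
    also have "\<dots> \<le> s * (dist y z + r)"
      using s c by (simp add: \<delta>_def algebra_simps)
    finally show "x \<in> ball y \<rho>" using s by simp
  qed
  have "(\<integral>x. bump w \<delta> x * f x \<partial>lebesgue) \<le> u * (\<integral>x. bump w \<delta> x \<partial>lebesgue)"
    using f_le \<delta> sub by (intro integral_bump_mult_le) (auto elim!: eventually_mono)
  also have "\<dots> < m * (\<integral>x. bump w \<delta> x \<partial>lebesgue)"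
    using s(1) integral_bump_pos[OF \<delta>, of w] by (simp add: m_def)
  finally have "\<forall>\<^sub>F n in sequentially. \<exists>x\<in>ball w \<delta>. fs n x < m"
    by (rule eventually_ex_less[OF \<delta>])
  with c(3) have "\<forall>\<^sub>F n in sequentially. \<forall>y'\<in>ball y \<delta>. fs n y' < \<eta>"
  proof eventually_elim
    case (elim n)
    show ?case
    proof (rule ballI, rule ccontr)
      fix y' assume y': "y' \<in> ball y \<delta>" and "\<not> fs n y' < \<eta>"
      then have ge: "\<eta> \<le> fs n y'" by simp
      obtain x where x: "x \<in> ball w \<delta>" "fs n x < m" using elim by blast
      have "dist ((1 - s) *\<^sub>R y' + s *\<^sub>R z) w = (1 - s) * dist y' y"
        using s by (simp add: w_def dist_norm flip: scaleR_diff_right)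
      also have "\<dots> \<le> dist y y'"
        using s by (simp add: dist_commute mult_left_le_one_le)
      also have "\<dots> < \<delta>" using y' by simp
      finally have "x \<in> ball ((1 - s) *\<^sub>R y' + s *\<^sub>R z) (s * r)"
        using x dist_triangle[of "(1 - s) *\<^sub>R y' + s *\<^sub>R z" x w] by (simp add: \<delta>_def)
      then have "m \<le> fs n x"
        unfolding m_def
        using elim c \<eta> s by (intro log_concave_fun_ge_ball[OF log_concave_fs _ _ _ ge]) auto
      then show False using x by simp
    qed
  qed
  then show ?thesis using \<delta> by blast
qed

text \<open>The counterpart of \<open>eventually_less_near\<close>: \<open>y\<close> is interior to
  the hull of a small ball around it, so finitely many points of that ball control a neighbourhood
  of \<open>y\<close>.\<close>

lemma eventually_ge_near_if:
  assumes \<rho>: "0 < \<rho>" and f_ge: "AE x in lebesgue. x \<in> ball y \<rho> \<longrightarrow> l \<le> f x" and l: "\<eta> < l"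
  shows "\<exists>\<delta>>0. \<forall>\<^sub>F n in sequentially. \<forall>y'\<in>ball y \<delta>. \<eta> \<le> fs n y'"
proof -
  have "y \<in> interior (convex hull (ball y (\<rho> / 2)))"
    using \<rho> by (simp add: hull_same)
  then obtain T r where T: "finite T" "T \<subseteq> ball y (\<rho> / 2)" "0 < r"
    "\<And>F m x. log_concave_fun F \<Longrightarrow> (\<And>t. t \<in> T \<Longrightarrow> \<exists>y\<in>ball t r. m \<le> F y) \<Longrightarrow>
       x \<in> ball y r \<Longrightarrow> m \<le> F x"
    using log_concave_fun_ge_near_hull[of y "ball y (\<rho> / 2)"] by blast
  \<comment> \<open>\<open>q \<le> r\<close> makes the good points admissible perturbations of
    \<open>T\<close>; \<open>q \<le> \<rho> / 2\<close> keeps the bumps inside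
    \<open>ball y \<rho>\<close>.\<close>
  define q where "q = min r (\<rho> / 2)"
  have q: "0 < q" "q \<le> r" "q \<le> \<rho> / 2" using T \<rho> by (auto simp: q_def)
  have "\<forall>\<^sub>F n in sequentially. \<forall>t\<in>T. \<exists>x\<in>ball t q. \<eta> \<le> fs n x"
  proof (intro eventually_ball_finite T ballI eventually_ex_ge q)
    fix t assume "t \<in> T"
    then have "dist y t < \<rho> / 2" using T by auto
    have sub: "ball t q \<subseteq> ball y \<rho>"
    proof
      fix x assume "x \<in> ball t q"
      then show "x \<in> ball y \<rho>"
        using \<open>dist y t < \<rho> / 2\<close> q dist_triangle[of y x t] by simp
    qed
    have "\<eta> * (\<integral>x. bump t q x \<partial>lebesgue) < l * (\<integral>x. bump t q x \<partial>lebesgue)"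
      using l integral_bump_pos[OF q(1), of t] by simp
    also have "\<dots> \<le> (\<integral>x. bump t q x * f x \<partial>lebesgue)"
      using f_ge q sub by (intro integral_bump_mult_ge) (auto elim!: eventually_mono)
    finally show "\<eta> * (\<integral>x. bump t q x \<partial>lebesgue) < (\<integral>x. bump t q x * f x \<partial>lebesgue)" .
  qed
  then have "\<forall>\<^sub>F n in sequentially. \<forall>x\<in>ball y r. \<eta> \<le> fs n x"
  proof (rule eventually_mono, intro ballI)
    fix n x assume elim: "\<forall>t\<in>T. \<exists>x\<in>ball t q. \<eta> \<le> fs n x" "x \<in> ball y r"
    have "\<exists>y\<in>ball t r. \<eta> \<le> fs n y" if "t \<in> T" for t
      using elim(1) that q subset_ball[of q r t] by blast
    then show "\<eta> \<le> fs n x" using elim(2) by (rule T(4)[OF log_concave_fs])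
  qed
  then show ?thesis using T by blast
qed


text \<open>Near such points the densities are uniformly Lipschitz, so their values are close to their
  averages against a narrow bump, which converge.\<close>
lemma convergent_on_hull_interior:
  assumes "z \<in> hull_interior"
  shows "convergent (\<lambda>n. fs n z)"
proof (rule convergent_if_eventually_close)
  fix e :: real assume e: "0 < e"
  obtain c r where c: "0 < c" "0 < r" "\<forall>\<^sub>F n in sequentially. \<forall>x\<in>ball z r. c \<le> fs n x"
    using assms by (rule eventually_ge_near)
  obtain M where M: "0 < M" "\<forall>\<^sub>F n in sequentially. \<forall>x. fs n x \<le> M"
    by (rule eventually_bounded)
  \<comment> \<open>The Lipschitz lemma needs the lower bound on a ball of twice the radius, hence
    \<open>r / 2\<close>.\<close>
  define L where "L = \<bar>M * ln (M / c) / (r / 2)\<bar>"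
  \<comment> \<open>Makes the oscillation \<open>L * \<rho>\<close> at most \<open>e / 2\<close>;
    the summand 1 guards against \<open>L = 0\<close>.\<close>
  define \<rho> where "\<rho> = min (r / 2) (e / (2 * (L + 1)))"
  have L: "0 \<le> L" by (simp add: L_def)
  have \<rho>: "0 < \<rho>" "\<rho> \<le> r / 2"
    unfolding \<rho>_def using c e L by (simp, intro min.cobounded1)
  have "L * \<rho> \<le> (L + 1) * (e / (2 * (L + 1)))"
    using L \<rho> by (intro mult_mono) (auto simp: \<rho>_def)
  also have "\<dots> = e / 2" using L by (simp add: field_simps)
  finally have L\<rho>: "L * \<rho> \<le> e / 2" .
  define I where "I = (\<integral>x. bump z \<rho> x \<partial>lebesgue)"
  have I: "0 < I" unfolding I_def by (rule integral_bump_pos[OF \<rho>(1)])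
  define J where "J n = (\<integral>x. bump z \<rho> x * fs n x \<partial>lebesgue)" for n
  define A where "A = (\<integral>x. bump z \<rho> x * f x \<partial>lebesgue) / I"
  have "(\<lambda>n. J n / I) \<longlonglongrightarrow> A"
    unfolding A_def J_def using I by (intro tendsto_divide tendsto_bump \<rho> tendsto_const) auto
  then have "\<forall>\<^sub>F n in sequentially. \<bar>J n / I - A\<bar> < e / 2"
    using e by (auto dest!: tendstoD[of _ _ _ "e / 2"] simp: dist_real_def)
  with c(3) M(2) have "\<forall>\<^sub>F n in sequentially. \<bar>fs n z - A\<bar> < e"
  proof eventually_elim
    case (elim n)
    have close: "\<bar>fs n x - fs n z\<bar> \<le> L * \<rho>" if x: "x \<in> ball z \<rho>" for x
    proof -
      have lip: "fs n p - fs n q \<le> L * \<rho>" if pq: "p \<in> ball z (r / 2)" "q \<in> ball z (r / 2)" "dist p q \<le> \<rho>"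
        for p q
      proof -
        have "fs n p - fs n q \<le> M * ln (M / c) / (r / 2) * norm (p - q)"
          using elim c pq by (intro log_concave_fun_Lipschitz_at[where z = z] log_concave_fs) auto
        also have "\<dots> \<le> L * norm (p - q)"
          unfolding L_def by (intro mult_right_mono abs_ge_self norm_ge_zero)
        also have "\<dots> \<le> L * \<rho>"
          using pq L by (intro mult_left_mono) (auto simp: dist_norm)
        finally show ?thesis .
      qed
      have "x \<in> ball z (r / 2)" "z \<in> ball z (r / 2)" "dist x z \<le> \<rho>"
        using x \<rho> by (auto simp: dist_commute)
      then show ?thesis
        using lip[of x z] lip[of z x] by (simp add: dist_commute abs_le_iff)
    qed
    have "(fs n z - L * \<rho>) * I \<le> J n"
      unfolding I_def J_def
    proof (intro integral_bump_mult_ge \<rho> AE_I2 impI)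
      show "fs n z - L * \<rho> \<le> fs n x" if "x \<in> ball z \<rho>" for x
        using close[OF that] by (simp add: abs_le_iff)
    qed simp
    then have 1: "fs n z - L * \<rho> \<le> J n / I" using I by (simp add: pos_le_divide_eq)
    have "J n \<le> (fs n z + L * \<rho>) * I"
      unfolding I_def J_def
    proof (intro integral_bump_mult_le \<rho> AE_I2 impI)
      show "fs n x \<le> fs n z + L * \<rho>" if "x \<in> ball z \<rho>" for x
        using close[OF that] by (simp add: abs_le_iff)
    qed simp
    then have 2: "J n / I \<le> fs n z + L * \<rho>" using I by (simp add: pos_divide_le_eq)
    show ?case using 1 2 elim(3) L\<rho> by linarith
  qed
  then show "\<exists>A. \<forall>\<^sub>F n in sequentially. \<bar>fs n z - A\<bar> < e" by blast
qed

text \<open>Here \<open>f\<close> vanishes almost everywhere on a ball around \<open>z\<close>, so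
  \<open>eventually_less_near\<close> applies with \<open>u = 0\<close> and every positive
  level.\<close>

lemma tendsto_0_off_closure:
  assumes "z \<notin> closure (convex hull supp)"
  shows "(\<lambda>n. fs n z) \<longlonglongrightarrow> 0"
proof (rule order_tendstoI)
  fix a :: real assume "a < 0"
  then have "a < fs n z" for n using fs_simps(2)[of n z] by linarith
  then show "\<forall>\<^sub>F n in sequentially. a < fs n z" by simp
next
  fix a :: real assume a: "0 < a"
  have "open (- closure (convex hull supp))" by (intro open_Compl closed_closure)
  then obtain \<rho> where \<rho>: "0 < \<rho>" "ball z \<rho> \<subseteq> - closure (convex hull supp)"
    using assms open_contains_ball[of "- closure (convex hull supp)"] by auto
  have "supp \<subseteq> closure (convex hull supp)"
    by (meson closure_subset hull_subset order_trans)
  then have "AE x in lebesgue. x \<in> ball z \<rho> \<longrightarrow> f x \<le> 0"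
    using AE_zero_off_supp \<rho>(2) by (auto elim!: eventually_mono)
  then obtain \<delta> where "0 < \<delta>" "\<forall>\<^sub>F n in sequentially. \<forall>y\<in>ball z \<delta>. fs n y < a"
    using eventually_less_near[OF \<rho>(1)] a by blast
  then show "\<forall>\<^sub>F n in sequentially. fs n z < a"
    by (auto elim!: eventually_mono)
qed

text \<open>On the frontier of the hull nothing is known about convergence. The value 0 there is
  compatible with log-concavity because \<open>hull_interior\<close> is convex.\<close>

definition limit_fun :: "'a \<Rightarrow> real" where
  "limit_fun x = (if x \<in> hull_interior then lim (\<lambda>n. fs n x) else 0)"

lemma tendsto_limit_fun_interior:
  "x \<in> hull_interior \<Longrightarrow> (\<lambda>n. fs n x) \<longlonglongrightarrow> limit_fun x"
  using convergent_on_hull_interior by (simp add: limit_fun_def convergent_LIMSEQ_iff)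

lemma tendsto_limit_fun_indicator:
  "(\<lambda>n. indicat_real hull_interior x * fs n x) \<longlonglongrightarrow> limit_fun x"
  using tendsto_limit_fun_interior[of x] by (cases "x \<in> hull_interior") (auto simp: limit_fun_def)

lemma limit_fun_nonneg: "0 \<le> limit_fun x"
  by (rule LIMSEQ_le_const[OF tendsto_limit_fun_indicator]) auto

lemma limit_fun_measurable [measurable]: "limit_fun \<in> borel_measurable lebesgue"
proof (rule borel_measurable_LIMSEQ_real[OF tendsto_limit_fun_indicator])
  have "hull_interior \<in> sets lebesgue" by (simp add: borel_open open_hull_interior)
  then show "(\<lambda>x. indicat_real hull_interior x * fs n x) \<in> borel_measurable lebesgue" for n
    by (intro borel_measurable_times borel_measurable_indicator fs_simps(1))
qed

lemma AE_tendsto_limit_fun: "AE x in lebesgue. (\<lambda>n. fs n x) \<longlonglongrightarrow> limit_fun x"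
proof -
  have "negligible (frontier (convex hull supp))"
    by (intro negligible_convex_frontier convex_convex_hull)
  then have "AE x in lebesgue. x \<notin> frontier (convex hull supp)"
    by (intro AE_not_in) (simp add: negligible_iff_null_sets)
  then show ?thesis
  proof eventually_elim
    case (elim x)
    then consider "x \<in> hull_interior" | "x \<notin> closure (convex hull supp)" "x \<notin> hull_interior"
      using interior_subset closure_subset by (fastforce simp: frontier_def hull_interior_def)
    then show ?case
      using tendsto_limit_fun_interior tendsto_0_off_closure by cases (auto simp: limit_fun_def)
  qed
qed

text \<open>Fatou's lemma gives mass at most 1; that no mass is lost follows only from the
  identification with \<open>f\<close>.\<close>

lemma integrable_limit_fun: "integrable lebesgue limit_fun"
proof (rule integrableI_nonneg)
  have "(\<integral>\<^sup>+x. ennreal (limit_fun x) \<partial>lebesgue) = (\<integral>\<^sup>+x. liminf (\<lambda>n. ennreal (fs n x)) \<partial>lebesgue)"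
    using AE_tendsto_limit_fun
    by (intro nn_integral_cong_AE)
      (auto elim!: eventually_mono intro!: lim_imp_Liminf[symmetric])
  also have "\<dots> \<le> liminf (\<lambda>n. \<integral>\<^sup>+x. ennreal (fs n x) \<partial>lebesgue)"
    by (intro nn_integral_liminf) auto
  also have "\<dots> = 1" by (simp add: Liminf_const)
  finally show "(\<integral>\<^sup>+x. ennreal (limit_fun x) \<partial>lebesgue) < \<infinity>"
    by (rule order_le_less_trans) simp
qed (auto simp: limit_fun_nonneg)

text \<open>On the bounded support of a test function the eventual bound \<open>M\<close> is an
  integrable majorant, so escape of mass to infinity cannot interfere. The shift by \<open>N\<close>
  drops the terms before the bound holds.\<close>

lemma AE_eq_limit_fun: "AE x in lebesgue. f x = limit_fun x"
proof (rule AE_eq_if_test_integrals_eq)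
  fix h :: "'a \<Rightarrow> real" and R
  assume h: "continuous_on UNIV h" "\<And>x. 0 \<le> h x" "\<And>x. h x \<le> 1" "\<And>x. x \<notin> cball 0 R \<Longrightarrow> h x = 0"
  have hm: "h \<in> borel_measurable lebesgue"
    using h(1) by (rule borel_measurable_lebesgue_continuous)
  have "bounded (range h)"
    using h by (intro boundedI[of _ 1]) (auto simp: abs_of_nonneg)
  then have 1: "(\<lambda>n. \<integral>x. h x * fs n x \<partial>lebesgue) \<longlonglongrightarrow> (\<integral>x. h x * f x \<partial>lebesgue)"
    using conv h(1) by (simp add: conv_in_distr_def)
  obtain M where M: "0 < M" "\<forall>\<^sub>F n in sequentially. \<forall>x. fs n x \<le> M"
    by (rule eventually_bounded)
  then obtain N where N: "\<And>n x. N \<le> n \<Longrightarrow> fs n x \<le> M"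
    by (auto simp: eventually_sequentially)
  have "(\<lambda>n. \<integral>x. h x * fs (n + N) x \<partial>lebesgue) \<longlonglongrightarrow> (\<integral>x. h x * limit_fun x \<partial>lebesgue)"
  proof (rule integral_dominated_convergence[where w = "\<lambda>x. M * indicat_real (cball 0 R) x"])
    show "integrable lebesgue (\<lambda>x. M * indicat_real (cball (0::'a) R) x)"
      by (auto simp: integrable_indicator_iff emeasure_lborel_cball_finite[simplified])
    show "AE x in lebesgue. (\<lambda>n. h x * fs (n + N) x) \<longlonglongrightarrow> h x * limit_fun x"
      using AE_tendsto_limit_fun
      by eventually_elim (intro tendsto_mult tendsto_const LIMSEQ_ignore_initial_segment)
    show "AE x in lebesgue. norm (h x * fs (n + N) x) \<le> M * indicat_real (cball 0 R) x" for n
    proof (rule AE_I2)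
      fix x
      have "h x * fs (n + N) x \<le> 1 * M"
        using h N M by (intro mult_mono) auto
      then show "norm (h x * fs (n + N) x) \<le> M * indicat_real (cball 0 R) x"
        using h(2)[of x] h(4)[of x] by (cases "x \<in> cball 0 R") (auto simp: abs_mult)
    qed
  qed (use hm in \<open>auto intro!: borel_measurable_times\<close>)
  then have "(\<lambda>n. \<integral>x. h x * fs n x \<partial>lebesgue) \<longlonglongrightarrow> (\<integral>x. h x * limit_fun x \<partial>lebesgue)"
    by (rule LIMSEQ_offset)
  with 1 show "(\<integral>x. h x * f x \<partial>lebesgue) = (\<integral>x. h x * limit_fun x \<partial>lebesgue)"
    by (rule LIMSEQ_unique)
qed (auto simp: limit_fun_nonneg integrable_limit_fun)

text \<open>If a factor on the left is 0 there is nothing to show. Otherwise all three points lie in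
  the convex set \<open>hull_interior\<close>, where the inequality passes to the limit.\<close>

lemma log_concave_limit_fun: "log_concave_density limit_fun"
proof -
  have "(\<integral>\<^sup>+x. ennreal (limit_fun x) \<partial>lebesgue) = (\<integral>\<^sup>+x. ennreal (f x) \<partial>lebesgue)"
    using AE_eq_limit_fun by (intro nn_integral_cong_AE) (auto elim!: eventually_mono)
  then have "prob_density limit_fun"
    by (intro prob_densityI) (auto simp: limit_fun_nonneg)
  moreover have "limit_fun x powr (1 - t) * limit_fun y powr t \<le> limit_fun ((1 - t) *\<^sub>R x + t *\<^sub>R y)"
    if t: "0 < t" "t < 1" for x y t
  proof (cases "limit_fun x = 0 \<or> limit_fun y = 0")
    case True
    then show ?thesis by (auto simp: limit_fun_nonneg)
  next
    case False
    then have xy: "x \<in> hull_interior" "y \<in> hull_interior"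
      by (auto simp: limit_fun_def split: if_splits)
    then have w: "(1 - t) *\<^sub>R x + t *\<^sub>R y \<in> hull_interior"
      using convex_hull_interior t by (simp add: convex_alt)
    show ?thesis
    proof (rule LIMSEQ_le)
      show "(\<lambda>n. fs n x powr (1 - t) * fs n y powr t) \<longlonglongrightarrow> limit_fun x powr (1 - t) * limit_fun y powr t"
        using False xy by (intro tendsto_intros tendsto_limit_fun_interior) auto
      show "(\<lambda>n. fs n ((1 - t) *\<^sub>R x + t *\<^sub>R y)) \<longlonglongrightarrow> limit_fun ((1 - t) *\<^sub>R x + t *\<^sub>R y)"
        by (rule tendsto_limit_fun_interior[OF w])
      show "\<exists>N. \<forall>n\<ge>N. fs n x powr (1 - t) * fs n y powr t \<le> fs n ((1 - t) *\<^sub>R x + t *\<^sub>R y)"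
        using log_concave_funD[OF log_concave_fs t] by blast
    qed
  qed
  ultimately show ?thesis
    by (simp add: log_concave_density_iff log_concave_fun_def limit_fun_nonneg)
qed

section \<open>Almost everywhere convergence and one-sided bounds on compact sets\<close>

lemma AE_tendsto: "AE x in lebesgue. (\<lambda>n. fs n x) \<longlonglongrightarrow> f x"
  using AE_tendsto_limit_fun AE_eq_limit_fun by eventually_elim simp

text \<open>Stated for a continuous majorant \<open>u\<close> so as to serve twice: with
  \<open>u = f\<close> for a continuous \<open>f\<close>, and with the exponential envelope for an
  arbitrary one.\<close>

lemma eventually_less_on_compact:
  assumes Q: "compact Q" and u: "continuous_on UNIV u" "\<And>x. f x \<le> u x" and e: "0 < e"
  shows "\<forall>\<^sub>F n in sequentially. \<forall>y\<in>Q. fs n y < u y + e"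
proof (rule eventually_compact[OF Q])
  fix y
  have "isCont u y" using u(1) by (simp add: continuous_on_eq_continuous_at)
  \<comment> \<open>One third of \<open>e\<close> bounds \<open>f\<close> by \<open>u y\<close> near
    \<open>y\<close>, one gives the strict gap required by \<open>eventually_less_near\<close>, and
    one returns from \<open>u y\<close> to \<open>u y'\<close>.\<close>
  then obtain \<rho> where \<rho>: "0 < \<rho>" "\<And>x. x \<in> ball y \<rho> \<Longrightarrow> \<bar>u x - u y\<bar> < e / 3"
    unfolding continuous_at_eps_delta dist_real_def using e
    by (metis dist_commute mem_ball zero_less_divide_iff zero_less_numeral)
  have "AE x in lebesgue. x \<in> ball y \<rho> \<longrightarrow> f x \<le> u y + e / 3"
  proof (intro AE_I2 impI)
    show "f x \<le> u y + e / 3" if "x \<in> ball y \<rho>" for x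
      using \<rho>(2)[OF that] u(2)[of x] by linarith
  qed
  moreover have "0 \<le> u y" using u(2)[of y] f_simps(2)[of y] by linarith
  ultimately obtain \<delta> where \<delta>: "0 < \<delta>" "\<forall>\<^sub>F n in sequentially. \<forall>y'\<in>ball y \<delta>. fs n y' < u y + 2 * e / 3"
    using eventually_less_near[OF \<rho>(1), of y "u y + e / 3" "u y + 2 * e / 3"] e by auto
  have "\<forall>\<^sub>F n in sequentially. \<forall>y'\<in>ball y (min \<delta> \<rho>). fs n y' < u y' + e"
    using \<delta>(2)
  proof eventually_elim
    case (elim n)
    have "fs n y' < u y' + e" if "y' \<in> ball y (min \<delta> \<rho>)" for y'
    proof -
      have "fs n y' < u y + 2 * e / 3" "\<bar>u y' - u y\<bar> < e / 3"
        using elim that \<rho>(2)[of y'] by auto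
      then show ?thesis by linarith
    qed
    then show ?case by blast
  qed
  then show "\<exists>\<delta>>0. \<forall>\<^sub>F n in sequentially. \<forall>y'\<in>ball y \<delta>. fs n y' < u y' + e"
    using \<delta>(1) \<rho>(1) by (intro exI[of _ "min \<delta> \<rho>"]) simp
qed

lemma eventually_greater_on_compact:
  assumes Q: "compact Q" and f: "continuous_on UNIV f" and e: "0 < e"
  shows "\<forall>\<^sub>F n in sequentially. \<forall>y\<in>Q. f y - e < fs n y"
proof (rule eventually_compact[OF Q])
  fix y
  have "isCont f y" using f by (simp add: continuous_on_eq_continuous_at)
  then obtain \<rho> where \<rho>: "0 < \<rho>" "\<And>x. x \<in> ball y \<rho> \<Longrightarrow> \<bar>f x - f y\<bar> < e / 3"
    unfolding continuous_at_eps_delta dist_real_def using e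
    by (metis dist_commute mem_ball zero_less_divide_iff zero_less_numeral)
  have "AE x in lebesgue. x \<in> ball y \<rho> \<longrightarrow> f y - e / 3 \<le> f x"
  proof (intro AE_I2 impI)
    show "f y - e / 3 \<le> f x" if "x \<in> ball y \<rho>" for x
      using \<rho>(2)[OF that] by linarith
  qed
  then obtain \<delta> where \<delta>: "0 < \<delta>" "\<forall>\<^sub>F n in sequentially. \<forall>y'\<in>ball y \<delta>. f y - 2 * e / 3 \<le> fs n y'"
    using eventually_ge_near_if[OF \<rho>(1), of y "f y - e / 3" "f y - 2 * e / 3"] e by auto
  have "\<forall>\<^sub>F n in sequentially. \<forall>y'\<in>ball y (min \<delta> \<rho>). f y' - e < fs n y'"
    using \<delta>(2)
  proof eventually_elim
    case (elim n)
    have "f y' - e < fs n y'" if "y' \<in> ball y (min \<delta> \<rho>)" for y'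
    proof -
      have "f y - 2 * e / 3 \<le> fs n y'" "\<bar>f y' - f y\<bar> < e / 3"
        using elim that \<rho>(2)[of y'] by auto
      then show ?thesis by linarith
    qed
    then show ?case by blast
  qed
  then show "\<exists>\<delta>>0. \<forall>\<^sub>F n in sequentially. \<forall>y'\<in>ball y \<delta>. f y' - e < fs n y'"
    using \<delta>(1) \<rho>(1) by (intro exI[of _ "min \<delta> \<rho>"]) simp
qed

end

section \<open>Exponential bounds\<close>

text \<open>On a large sphere around a point where the densities are at least \<^term>\<open>c\<close> they are so small
  that log-concavity along rays forces exponential decay beyond it.\<close>
lemma log_concave_fun_exp_decay:
  fixes F :: "'a::real_normed_vector \<Rightarrow> real"
  assumes F: "log_concave_fun F" and c: "0 < c" "c \<le> F z" and R: "0 < R"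
    and sphere: "\<And>y. y \<in> sphere z R \<Longrightarrow> F y \<le> c * exp (- a * R)"
    and x: "R \<le> dist z x"
  shows "F x \<le> c * exp (- a * dist z x)"
proof -
  define d where "d = dist z x"
  \<comment> \<open>With this weight the point \<open>y\<close> below is where the segment from
    \<open>z\<close> to \<open>x\<close> meets the sphere of radius \<open>R\<close>.\<close>
  define t where "t = R / d"
  have d: "0 < d" "R \<le> d" using x R by (auto simp: d_def)
  show ?thesis
  proof (cases "R = d")
    case True
    then show ?thesis using sphere[of x] by (simp add: d_def)
  next
    case False
    then have t: "0 < t" "t < 1" using d R by (auto simp: t_def)
    define y where "y = (1 - t) *\<^sub>R z + t *\<^sub>R x"
    have "y - z = t *\<^sub>R (x - z)" by (simp add: y_def algebra_simps)
    then have "dist z y = t * d"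
      using t by (simp add: dist_norm d_def norm_minus_commute)
    then have "y \<in> sphere z R" using d by (simp add: t_def)
    have "c powr (1 - t) * F x powr t \<le> F y"
      unfolding y_def using F t c log_concave_fun_nonneg[OF F]
      by (intro log_concave_fun_ge) auto
    also have "\<dots> \<le> c * exp (- a * R)"
      by (rule sphere) fact
    \<comment> \<open>Written so that the factor \<open>c powr (1 - t)\<close> cancels and the claim
      is left as a comparison of \<open>t\<close>-th powers.\<close>
    also have "\<dots> = c powr (1 - t) * (c * exp (- a * d)) powr t"
    proof -
      have "(exp (- a * d)) powr t = exp (- a * R)"
        using d by (simp add: powr_def t_def)
      moreover have "c powr (1 - t) * c powr t = c"
        using c by (simp flip: powr_add)
      ultimately show ?thesis
        using c by (simp add: powr_mult)
    qed
    finally have "F x powr t \<le> (c * exp (- a * d)) powr t"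
      using c by simp
    then have "F x \<le> c * exp (- a * d)"
      using t c powr_less_mono2[of t "c * exp (- a * d)" "F x"] by (intro leI notI) simp
    then show ?thesis by (simp add: d_def)
  qed
qed

context log_concave_weak_limit
begin

text \<open>The rate must drop strictly below \<open>a0\<close>: the gap \<open>a0 - a\<close> is
  what overcomes the fixed ratio of the envelope to \<open>c\<close> on a large sphere.\<close>

lemma eventually_exp_bound:
  assumes a: "0 \<le> a" "a < a0" and f_le: "\<And>x. f x \<le> exp (- a0 * norm x + b0)"
  obtains C where "0 \<le> C" "\<forall>\<^sub>F n in sequentially. \<forall>x. fs n x \<le> C * exp (- a * norm x)"
proof -
  obtain z where "z \<in> hull_interior" using hull_interior_nonempty by blast
  then obtain c r where c: "0 < c" "0 < r" "\<forall>\<^sub>F n in sequentially. \<forall>x\<in>ball z r. c \<le> fs n x"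
    by (rule eventually_ge_near)
  obtain M where M: "0 < M" "\<forall>\<^sub>F n in sequentially. \<forall>x. fs n x \<le> M"
    by (rule eventually_bounded)
  \<comment> \<open>Recentres the envelope at \<open>z\<close>: by the triangle inequality
    \<open>f y\<close> is at most \<open>K * exp (- a0 * R)\<close> on the sphere of radius
    \<open>R\<close> around \<open>z\<close>.\<close>
  define K where "K = exp (a0 * norm z + b0)"
  \<comment> \<open>Large enough for \<open>2 * K * exp (- a0 * R) \<le> c * exp (- a * R)\<close>.
    The factor 2 covers the envelope and an error of the same size on the sphere; the summand 1
    makes \<open>R\<close> positive.\<close>
  define R where "R = \<bar>ln (2 * K / c)\<bar> / (a0 - a) + 1"
  have R: "0 < R" using a by (simp add: R_def add_nonneg_pos)
  have K: "0 < K" by (simp add: K_def)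
  have "ln (2 * K / c) \<le> (a0 - a) * R"
  proof -
    have "(a0 - a) * R = \<bar>ln (2 * K / c)\<bar> + (a0 - a)"
      using a by (simp add: R_def distrib_left)
    then show ?thesis using a by linarith
  qed
  then have "2 * K / c \<le> exp ((a0 - a) * R)"
    using K c by (metis exp_le_cancel_iff exp_ln divide_pos_pos mult_pos_pos zero_less_numeral)
  then have "2 * K * exp (- a0 * R) \<le> c * exp ((a0 - a) * R) * exp (- a0 * R)"
    using c by (intro mult_right_mono) (simp_all add: field_simps)
  also have "\<dots> = c * exp (- a * R)"
    by (simp add: mult.assoc exp_add[symmetric] algebra_simps)
  finally have KR: "2 * K * exp (- a0 * R) \<le> c * exp (- a * R)" .
  have "\<forall>\<^sub>F n in sequentially. \<forall>y\<in>sphere z R. fs n y < exp (- a0 * norm y + b0) + K * exp (- a0 * R)"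
    using f_le K by (intro eventually_less_on_compact compact_sphere) (auto intro!: continuous_intros)
  \<comment> \<open>The constant \<open>c\<close> serves beyond the sphere, and
    \<open>M * exp (a * R)\<close> turns the global bound into an exponential one inside it.\<close>
  with c(3) M(2) have "\<forall>\<^sub>F n in sequentially. \<forall>x. fs n x \<le> max c (M * exp (a * R)) * exp (- a * dist z x)"
  proof eventually_elim
    case (elim n)
    show ?case
    proof
      fix x
      have sphere: "fs n y \<le> c * exp (- a * R)" if "y \<in> sphere z R" for y
      proof -
        have "R \<le> norm y + norm z"
          using that norm_triangle_ineq4[of z y] by (simp add: dist_norm)
        then have "a0 * R \<le> a0 * (norm y + norm z)"
          using a by (intro mult_left_mono) auto
        then have "exp (- a0 * norm y + b0) \<le> K * exp (- a0 * R)"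
          by (simp add: K_def exp_add[symmetric] algebra_simps)
        then show ?thesis using elim(3) that KR by fastforce
      qed
      show "fs n x \<le> max c (M * exp (a * R)) * exp (- a * dist z x)"
      proof (cases "R \<le> dist z x")
        case True
        have "fs n x \<le> c * exp (- a * dist z x)"
          using elim c R True sphere by (intro log_concave_fun_exp_decay[OF log_concave_fs]) auto
        also have "\<dots> \<le> max c (M * exp (a * R)) * exp (- a * dist z x)"
          by (intro mult_right_mono) auto
        finally show ?thesis .
      next
        case False
        have "fs n x \<le> M * 1" using elim by simp
        also have "\<dots> \<le> M * exp (a * R - a * dist z x)"
          using False a M by (intro mult_left_mono) (auto intro!: mult_left_mono)
        also have "\<dots> = M * exp (a * R) * exp (- a * dist z x)"
          by (simp add: mult.assoc exp_add[symmetric])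
        also have "\<dots> \<le> max c (M * exp (a * R)) * exp (- a * dist z x)"
          by (intro mult_right_mono) auto
        finally show ?thesis .
      qed
    qed
  qed
  then have "\<forall>\<^sub>F n in sequentially. \<forall>x. fs n x \<le>
      (max c (M * exp (a * R)) * exp (a * norm z)) * exp (- a * norm x)"
  proof (rule eventually_mono, intro allI)
    fix n x assume *: "\<forall>x. fs n x \<le> max c (M * exp (a * R)) * exp (- a * dist z x)"
    have "norm x \<le> norm z + dist z x"
      using norm_triangle_sub[of x z] by (simp add: dist_norm norm_minus_commute)
    then have "a * norm x \<le> a * (norm z + dist z x)"
      using a by (intro mult_left_mono)
    then have "exp (- a * dist z x) \<le> exp (a * norm z) * exp (- a * norm x)"
      by (simp add: exp_add[symmetric] algebra_simps)
    then have "max c (M * exp (a * R)) * exp (- a * dist z x) \<le>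
        max c (M * exp (a * R)) * (exp (a * norm z) * exp (- a * norm x))"
      using c by (intro mult_left_mono) auto
    then show "fs n x \<le> (max c (M * exp (a * R)) * exp (a * norm z)) * exp (- a * norm x)"
      using *[rule_format, of x] by (simp add: mult.assoc)
  qed
  then show thesis using c by (intro that[of "max c (M * exp (a * R)) * exp (a * norm z)"]) auto
qed

section \<open>Convergence with exponential weights\<close>

lemma eventually_weighted_bound:
  assumes a: "0 < a0" "a < a0" and f_le: "\<And>x. f x \<le> exp (- a0 * norm x + b0)"
  obtains C e where "0 < C" "0 < e"
    "\<forall>\<^sub>F n in sequentially. \<forall>x. exp (a * norm x) * \<bar>fs n x - f x\<bar> \<le> C * exp (- e * norm x)"
proof -
  \<comment> \<open>A rate strictly between \<open>a\<close> and \<open>a0\<close> that is also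
    nonnegative, since \<open>a\<close> may be negative; \<open>a' - a\<close> is the decay left
    after weighting.\<close>
  define a' where "a' = (max a 0 + a0) / 2"
  have a': "0 \<le> a'" "a < a'" "a' < a0" using a by (auto simp: a'_def max_def)
  obtain C where C: "0 \<le> C" "\<forall>\<^sub>F n in sequentially. \<forall>x. fs n x \<le> C * exp (- a' * norm x)"
    using eventually_exp_bound[OF a'(1,3) f_le] by blast
  have f_le': "f x \<le> exp b0 * exp (- a' * norm x)" for x
  proof -
    have "a' * norm x \<le> a0 * norm x" using a' by (intro mult_right_mono) auto
    then have "exp (- a0 * norm x + b0) \<le> exp b0 * exp (- a' * norm x)"
      by (simp add: exp_add[symmetric])
    with f_le[of x] show ?thesis by linarith
  qed
  have "\<forall>\<^sub>F n in sequentially. \<forall>x. exp (a * norm x) * \<bar>fs n x - f x\<bar> \<le> (C + exp b0) * exp (- (a' - a) * norm x)"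
    using C(2)
  proof (rule eventually_mono, intro allI)
    fix n x assume *: "\<forall>x. fs n x \<le> C * exp (- a' * norm x)"
    have "\<bar>fs n x - f x\<bar> \<le> fs n x + f x"
      using fs_simps(2)[of n x] f_simps(2)[of x] by linarith
    also have "\<dots> \<le> (C + exp b0) * exp (- a' * norm x)"
      using *[rule_format, of x] f_le'[of x] by (simp add: algebra_simps)
    finally have "exp (a * norm x) * \<bar>fs n x - f x\<bar> \<le> exp (a * norm x) * ((C + exp b0) * exp (- a' * norm x))"
      by (intro mult_left_mono) auto
    also have "\<dots> = (C + exp b0) * (exp (a * norm x) * exp (- a' * norm x))"
      by simp
    also have "exp (a * norm x) * exp (- a' * norm x) = exp (- (a' - a) * norm x)"
      by (simp add: exp_add[symmetric] algebra_simps)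
    finally show "exp (a * norm x) * \<bar>fs n x - f x\<bar> \<le> (C + exp b0) * exp (- (a' - a) * norm x)" .
  qed
  then show thesis using C(1) a' by (intro that[of "C + exp b0" "a' - a"]) (auto simp: add_nonneg_pos)
qed

text \<open>The integral is taken in \<open>ennreal\<close>, so convergence to 0 includes eventual
  finiteness; a real-valued integral would be 0 by default for a non-integrable function.\<close>

lemma weighted_L1_convergence:
  assumes "0 < a0" "a < a0" and "\<And>x. f x \<le> exp (- a0 * norm x + b0)"
  shows "(\<lambda>n. \<integral>\<^sup>+x. ennreal (exp (a * norm x) * \<bar>fs n x - f x\<bar>) \<partial>lebesgue) \<longlonglongrightarrow> 0"
proof -
  obtain C e where C: "0 < C" "0 < e"
    "\<forall>\<^sub>F n in sequentially. \<forall>x. exp (a * norm x) * \<bar>fs n x - f x\<bar> \<le> C * exp (- e * norm x)"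
    by (rule eventually_weighted_bound[OF assms])
  then obtain N where N: "\<And>n x. N \<le> n \<Longrightarrow> exp (a * norm x) * \<bar>fs n x - f x\<bar> \<le> C * exp (- e * norm x)"
    by (auto simp: eventually_sequentially)
  have exp_meas: "(\<lambda>x::'a. exp (b * norm x)) \<in> borel_measurable lebesgue" for b
    by (intro borel_measurable_lebesgue_continuous continuous_intros)
  have "(\<lambda>n. \<integral>\<^sup>+x. ennreal (exp (a * norm x) * \<bar>fs (n + N) x - f x\<bar>) \<partial>lebesgue) \<longlonglongrightarrow>
      (\<integral>\<^sup>+x. 0 \<partial>(lebesgue :: 'a measure))"
  proof (rule nn_integral_dominated_convergence[where w = "\<lambda>x. ennreal (C * exp (- e * norm x))"])
    show "(\<lambda>x. ennreal (exp (a * norm x) * \<bar>fs (n + N) x - f x\<bar>)) \<in> borel_measurable lebesgue" for n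
      by (intro measurable_compose[OF _ measurable_ennreal] borel_measurable_times exp_meas
          borel_measurable_abs borel_measurable_diff fs_simps(1) f_simps(1))
    show "(\<lambda>x::'a. ennreal (C * exp (- e * norm x))) \<in> borel_measurable lebesgue"
      by (intro measurable_compose[OF _ measurable_ennreal] borel_measurable_times exp_meas) simp
    have "(\<integral>\<^sup>+x. ennreal (C * exp (- e * norm x)) \<partial>(lebesgue :: 'a measure)) =
        (\<integral>\<^sup>+x. ennreal C * ennreal (exp (- e * norm x)) \<partial>(lebesgue :: 'a measure))"
      using C by (intro nn_integral_cong) (simp add: ennreal_mult)
    also have "\<dots> = ennreal C * (\<integral>\<^sup>+x. ennreal (exp (- e * norm x)) \<partial>(lebesgue :: 'a measure))"
      by (intro nn_integral_cmult measurable_compose[OF _ measurable_ennreal] exp_meas)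
    also have "\<dots> < \<infinity>"
      using nn_integral_exp_neg_norm_finite[OF C(2), where 'a = 'a] by (simp add: ennreal_mult_less_top)
    finally show "(\<integral>\<^sup>+x. ennreal (C * exp (- e * norm x)) \<partial>(lebesgue :: 'a measure)) < \<infinity>" .
    show "AE x in lebesgue. ennreal (exp (a * norm x) * \<bar>fs (n + N) x - f x\<bar>) \<le> ennreal (C * exp (- e * norm x))" for n
      using N[of "n + N"] by (intro AE_I2 ennreal_leI) simp
    show "AE x in lebesgue. (\<lambda>n. ennreal (exp (a * norm x) * \<bar>fs (n + N) x - f x\<bar>)) \<longlonglongrightarrow> 0"
      using AE_tendsto
    proof eventually_elim
      case (elim x)
      have "(\<lambda>n. exp (a * norm x) * \<bar>fs (n + N) x - f x\<bar>) \<longlonglongrightarrow> exp (a * norm x) * \<bar>f x - f x\<bar>"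
        using elim by (intro tendsto_intros LIMSEQ_ignore_initial_segment)
      then show ?case using tendsto_ennrealI by fastforce
    qed
  qed simp
  then have "(\<lambda>n. \<integral>\<^sup>+x. ennreal (exp (a * norm x) * \<bar>fs (n + N) x - f x\<bar>) \<partial>lebesgue) \<longlonglongrightarrow> 0"
    by simp
  then show ?thesis by (rule LIMSEQ_offset)
qed

lemma weighted_uniform_convergence:
  assumes "0 < a0" "a < a0" and "\<And>x. f x \<le> exp (- a0 * norm x + b0)"
    and f: "continuous_on UNIV f"
  shows "(\<lambda>n. SUP x. ennreal (exp (a * norm x) * \<bar>fs n x - f x\<bar>)) \<longlonglongrightarrow> 0"
proof -
  obtain C e where C: "0 < C" "0 < e"
    "\<forall>\<^sub>F n in sequentially. \<forall>x. exp (a * norm x) * \<bar>fs n x - f x\<bar> \<le> C * exp (- e * norm x)"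
    by (rule eventually_weighted_bound[OF assms(1-3)])
  have unif: "\<forall>\<^sub>F n in sequentially. \<forall>x. exp (a * norm x) * \<bar>fs n x - f x\<bar> \<le> \<epsilon>" if \<epsilon>: "0 < \<epsilon>" for \<epsilon> :: real
  proof -
    \<comment> \<open>Beyond this radius the common bound \<open>C * exp (- e * norm x)\<close> is
      at most \<epsilon>.\<close>
    define R where "R = \<bar>ln (C / \<epsilon>)\<bar> / e"
    \<comment> \<open>On the ball the weight is at most \<open>exp (\<bar>a\<bar> * R)\<close>,
      whatever the sign of \<open>a\<close>, so an unweighted error \<open>q\<close> suffices
      there.\<close>
    define q where "q = \<epsilon> / exp (\<bar>a\<bar> * R)"
    have q: "0 < q" using \<epsilon> by (simp add: q_def)
    have "\<forall>\<^sub>F n in sequentially. \<forall>y\<in>cball 0 R. fs n y < f y + q"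
      using f q by (intro eventually_less_on_compact) auto
    moreover have "\<forall>\<^sub>F n in sequentially. \<forall>y\<in>cball 0 R. f y - q < fs n y"
      using f q by (intro eventually_greater_on_compact) auto
    ultimately show ?thesis
      using C(3)
    proof eventually_elim
      case (elim n)
      show ?case
      proof
        fix x
        show "exp (a * norm x) * \<bar>fs n x - f x\<bar> \<le> \<epsilon>"
        proof (cases "norm x \<le> R")
          case True
          have "\<bar>fs n x - f x\<bar> \<le> q"
            using elim(1,2) True by (force simp: abs_le_iff)
          moreover have "exp (a * norm x) \<le> exp (\<bar>a\<bar> * R)"
            using True by (simp add: mult_mono)
          ultimately have "exp (a * norm x) * \<bar>fs n x - f x\<bar> \<le> exp (\<bar>a\<bar> * R) * q"
            by (intro mult_mono) auto
          then show ?thesis by (simp add: q_def)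
        next
          case False
          then have "e * R \<le> e * norm x" using C by simp
          moreover have "ln (C / \<epsilon>) \<le> e * R" using C by (simp add: R_def)
          ultimately have "ln (C / \<epsilon>) \<le> e * norm x" by simp
          then have "C / \<epsilon> \<le> exp (e * norm x)"
            using C \<epsilon> by (metis exp_le_cancel_iff exp_ln divide_pos_pos)
          then have "C * exp (- e * norm x) \<le> \<epsilon>"
            using \<epsilon> by (simp add: exp_minus field_simps)
          then show ?thesis using elim(3) order_trans by blast
        qed
      qed
    qed
  qed
  show ?thesis
  proof (rule order_tendstoI)
    fix u :: ennreal assume "0 < u"
    then obtain v where v: "0 < v" "v < u" using dense by blast
    then obtain \<epsilon> where "v = ennreal \<epsilon>" by (cases v) auto
    with v have \<epsilon>: "0 < \<epsilon>" "ennreal \<epsilon> < u" by (auto simp: ennreal_less_zero_iff)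
    show "\<forall>\<^sub>F n in sequentially. (SUP x. ennreal (exp (a * norm x) * \<bar>fs n x - f x\<bar>)) < u"
      using unif[OF \<epsilon>(1)]
    proof eventually_elim
      case (elim n)
      then have "(SUP x. ennreal (exp (a * norm x) * \<bar>fs n x - f x\<bar>)) \<le> ennreal \<epsilon>"
        by (intro SUP_least ennreal_leI) simp
      then show ?case using \<epsilon> by simp
    qed
  qed simp
qed

end

text \<open>Changing \<open>f\<close> on a null set alters none of the limits of integrals but can
  destroy a pointwise inequality; log-concavity of the limit is therefore asserted for a version
  \<open>g\<close>, here \<open>limit_fun\<close>.\<close>

theorem proposition2:
  fixes fs :: "nat \<Rightarrow> real ^ 'd \<Rightarrow> real" and f :: "real ^ 'd \<Rightarrow> real"
  assumes "\<And>n. log_concave_density (fs n)"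
    and "prob_density f"
    and "conv_in_distr fs f"
  shows "(\<exists>g. log_concave_density g \<and> (AE x in lebesgue. f x = g x)) \<and>
         (AE x in lebesgue. (\<lambda>n. fs n x) \<longlonglongrightarrow> f x) \<and>
         (\<forall>a0 b0 :: real. a0 > 0 \<and> (\<forall>x. f x \<le> exp (- a0 * norm x + b0)) \<longrightarrow>
            (\<forall>a < a0.
               (\<lambda>n. \<integral>\<^sup>+x. ennreal (exp (a * norm x) * \<bar>fs n x - f x\<bar>) \<partial>lebesgue)
                  \<longlonglongrightarrow> 0 \<and>
               (continuous_on UNIV f \<longrightarrow>
                  (\<lambda>n. SUP x. ennreal (exp (a * norm x) * \<bar>fs n x - f x\<bar>)) \<longlonglongrightarrow> 0)))"
proof -
  interpret log_concave_weak_limit fs f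
    using assms by unfold_locales
  show ?thesis
    using log_concave_limit_fun AE_eq_limit_fun AE_tendsto weighted_L1_convergence
      weighted_uniform_convergence by blast
qed

end
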